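(* Let $K/k$ be a q-finite purely inseparable extension of unbounded exponent. Then $dm(K/k)\le di(rp(K/k)/k)$.
   Context: Fields lie in an algebraic closure of $k$, characteristic $p>0$. $di(K/k)=\sup_n|G_n|$, $G_n$ a minimal generating set of $(k^{p^{-n}}\cap K)/k$; q-finite: $di<\infty$. $rp(K/k)$: largest subextension $F$ with $k(F^p)=F$. Modular: for every $n$, $K^{p^n}$ and $k$ are $(k\cap K^{p^n})$-linearly disjoint; lq-modular: $K$ modular over a finite subextension. $K/k$ is $i$-modular if there is a chain $k=F_0\subseteq\cdots\subseteq F_i=K$ with each $F_{j+1}/F_j$ lq-modular; $dm(K/k)$ is the least such $i$. *)

theory Defs
  imports Main "HOL-Library.Extended_Nat"
begin

text \<open>All fields are subfields (as sets) of an ambient field of type 'a of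
positive characteristic CHAR('a).\<close>

definition is_subfield :: "'a::field set \<Rightarrow> bool" where
  "is_subfield F \<longleftrightarrow> 0 \<in> F \<and> 1 \<in> F \<and>
     (\<forall>x\<in>F. \<forall>y\<in>F. x + y \<in> F \<and> x - y \<in> F \<and> x * y \<in> F) \<and>
     (\<forall>x\<in>F. inverse x \<in> F)"

definition gen :: "'a::field set \<Rightarrow> 'a set \<Rightarrow> 'a set" where
  "gen k S = \<Inter>{F. is_subfield F \<and> k \<union> S \<subseteq> F}"

definition ecard :: "'b set \<Rightarrow> enat" where
  "ecard G = (if finite G then enat (card G) else \<infinity>)"

definition gen_num :: "'a::field set \<Rightarrow> 'a set \<Rightarrow> enat" where
  "gen_num k E = (INF G\<in>{G. G \<subseteq> E \<and> gen k G = E}. ecard G)"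

definition root_part :: "nat \<Rightarrow> 'a::field set \<Rightarrow> 'a set \<Rightarrow> 'a set" where
  "root_part n k K = {x\<in>K. x ^ (CHAR('a) ^ n) \<in> k}"

definition di :: "'a::field set \<Rightarrow> 'a set \<Rightarrow> enat" where
  "di k K = (SUP n. gen_num k (root_part n k K))"

definition q_finite :: "'a::field set \<Rightarrow> 'a set \<Rightarrow> bool" where
  "q_finite k K \<longleftrightarrow> di k K < \<infinity>"

definition purely_inseparable :: "'a::field set \<Rightarrow> 'a set \<Rightarrow> bool" where
  "purely_inseparable k K \<longleftrightarrow> is_subfield k \<and> is_subfield K \<and> k \<subseteq> K \<and>
     (\<forall>x\<in>K. \<exists>n. x ^ (CHAR('a) ^ n) \<in> k)"

definition unbounded_exponent :: "'a::field set \<Rightarrow> 'a set \<Rightarrow> bool" where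
  "unbounded_exponent k K \<longleftrightarrow> \<not> (\<exists>n. \<forall>x\<in>K. x ^ (CHAR('a) ^ n) \<in> k)"

definition rp :: "'a::field set \<Rightarrow> 'a set \<Rightarrow> 'a set" where
  "rp k K = (GREATEST F. is_subfield F \<and> k \<subseteq> F \<and> F \<subseteq> K \<and>
                gen k ((\<lambda>x. x ^ CHAR('a)) ` F) = F)"

definition lin_indep :: "'a::field set \<Rightarrow> 'a set \<Rightarrow> bool" where
  "lin_indep C S \<longleftrightarrow> (\<forall>T c. finite T \<and> T \<subseteq> S \<and> (\<forall>s\<in>T. c s \<in> C) \<and>
       (\<Sum>s\<in>T. c s * s) = 0 \<longrightarrow> (\<forall>s\<in>T. c s = 0))"

definition lin_disjoint :: "'a::field set \<Rightarrow> 'a set \<Rightarrow> 'a set \<Rightarrow> bool" where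
  "lin_disjoint C A B \<longleftrightarrow> (\<forall>S. S \<subseteq> A \<and> lin_indep C S \<longrightarrow> lin_indep B S)"

definition modular :: "'a::field set \<Rightarrow> 'a set \<Rightarrow> bool" where
  "modular k K \<longleftrightarrow> (\<forall>n. lin_disjoint (k \<inter> (\<lambda>x. x ^ (CHAR('a) ^ n)) ` K)
                               ((\<lambda>x. x ^ (CHAR('a) ^ n)) ` K) k)"

definition finite_ext :: "'a::field set \<Rightarrow> 'a set \<Rightarrow> bool" where
  "finite_ext k L \<longleftrightarrow> (\<exists>S. finite S \<and> S \<subseteq> L \<and>
      (\<forall>x\<in>L. \<exists>c. (\<forall>s\<in>S. c s \<in> k) \<and> x = (\<Sum>s\<in>S. c s * s)))"

definition lq_modular :: "'a::field set \<Rightarrow> 'a set \<Rightarrow> bool" where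
  "lq_modular k K \<longleftrightarrow> (\<exists>L. is_subfield L \<and> k \<subseteq> L \<and> L \<subseteq> K \<and> finite_ext k L \<and> modular L K)"

definition i_modular :: "nat \<Rightarrow> 'a::field set \<Rightarrow> 'a set \<Rightarrow> bool" where
  "i_modular i k K \<longleftrightarrow> (\<exists>F::nat \<Rightarrow> 'a set. F 0 = k \<and> F i = K \<and>
      (\<forall>j\<le>i. is_subfield (F j)) \<and>
      (\<forall>j<i. F j \<subseteq> F (Suc j) \<and> lq_modular (F j) (F (Suc j))))"

definition dm :: "'a::field set \<Rightarrow> 'a set \<Rightarrow> enat" where
  "dm k K = (if \<exists>i. i_modular i k K then enat (LEAST i. i_modular i k K) else \<infinity>)"

end

theory Submission
  imports Defs "HOL-Algebra.Algebraic_Closure_Type"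
begin

text \<open>
  Since \<open>K/k\<close> is \<open>q\<close>-finite, \<open>R = rp(K/k)\<close> is \<open>k(K\<^bsup>p\<^sup>n\<^esup>)\<close> for large \<open>n\<close>, and \<open>K\<close> is finite over \<open>R\<close>.
  Put \<open>E\<^sub>c = \<Inter>\<^sub>j k(R\<^sub>c\<^sub>+\<^sub>j\<^bsup>p\<^sup>j\<^esup>)\<close>, where \<open>R\<^sub>n\<close> consists of the elements of \<open>R\<close> of exponent at most \<open>n\<close>. Then
  \<open>k(E\<^sub>c\<^sub>+\<^sub>1\<^bsup>p\<^esup>) = E\<^sub>c\<close>, and the degrees \<open>[E\<^sub>c\<^sub>+\<^sub>1 : E\<^sub>c]\<close> are nondecreasing and bounded, hence eventually constant;
  this makes \<open>m = \<Union>\<^sub>c E\<^sub>c\<close> modular over some \<open>E\<^sub>c\<close>, which is finite over \<open>k\<close>. If \<open>R \<noteq> k\<close>, then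
  \<open>m\<close> contains for every \<open>n\<close> an element of exact exponent \<open>n\<close>, which can replace one of the generators of \<open>R\<^sub>n\<close>, so
  that one generator fewer suffices over \<open>m\<close>. Induction on \<open>di(R/k)\<close> finishes the proof; when it is \<open>1\<close>, every finite
  subset of \<open>R\<close> lies in a simple extension of \<open>k\<close>, and \<open>K/k\<close> itself is lq-modular.
\<close>

subsection \<open>Generated subfields and the Frobenius map\<close>

lemma is_subfieldD:
  assumes "is_subfield F"
  shows "0 \<in> F" "1 \<in> F" "x \<in> F \<Longrightarrow> y \<in> F \<Longrightarrow> x + y \<in> F" "x \<in> F \<Longrightarrow> y \<in> F \<Longrightarrow> x - y \<in> F"
    "x \<in> F \<Longrightarrow> y \<in> F \<Longrightarrow> x * y \<in> F" "x \<in> F \<Longrightarrow> inverse x \<in> F"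
    "x \<in> F \<Longrightarrow> - x \<in> F" "x \<in> F \<Longrightarrow> x ^ n \<in> F" "x \<in> F \<Longrightarrow> y \<in> F \<Longrightarrow> x / y \<in> F"
proof -
  show *: "0 \<in> F" "1 \<in> F" "\<And>x y. x \<in> F \<Longrightarrow> y \<in> F \<Longrightarrow> x + y \<in> F"
    "\<And>x y. x \<in> F \<Longrightarrow> y \<in> F \<Longrightarrow> x - y \<in> F"
    "\<And>x y. x \<in> F \<Longrightarrow> y \<in> F \<Longrightarrow> x * y \<in> F" "\<And>x. x \<in> F \<Longrightarrow> inverse x \<in> F"
    using assms by (auto simp: is_subfield_def)
  show "- x \<in> F" if "x \<in> F" using *(4)[OF *(1) that] by simp
  show "x ^ n \<in> F" if "x \<in> F" using * that by (induction n) auto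
  show "x / y \<in> F" if "x \<in> F" "y \<in> F" using * that by (simp add: divide_inverse)
qed

lemma gen_subfield: "is_subfield (gen k S)"
  by (auto simp: gen_def is_subfield_def)

lemma gen_base: "k \<subseteq> gen k S" and gen_gens: "S \<subseteq> gen k S"
  by (auto simp: gen_def)

lemma gen_least: "is_subfield F \<Longrightarrow> k \<subseteq> F \<Longrightarrow> S \<subseteq> F \<Longrightarrow> gen k S \<subseteq> F"
  by (auto simp: gen_def)

lemma gen_mono: "k \<subseteq> k' \<Longrightarrow> S \<subseteq> S' \<Longrightarrow> gen k S \<subseteq> gen k' S'"
  by (rule gen_least[OF gen_subfield]) (use gen_base gen_gens in blast)+

lemma gen_gen: "gen (gen k A) B = gen k (A \<union> B)"
  using gen_least[OF gen_subfield, of "gen k A" k "A \<union> B" B]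
    gen_least[OF gen_subfield, of k "gen k A" B "A \<union> B"]
    gen_least[OF gen_subfield, of k k "A \<union> B" A] gen_base[of k] gen_gens gen_base
  by (metis (no_types, lifting) subset_antisym subset_trans Un_subset_iff)

lemma gen_absorb: "is_subfield k \<Longrightarrow> S \<subseteq> k \<Longrightarrow> gen k S = k"
  using gen_least[of k k S] gen_base by blast

lemma gen_eqI:
  assumes "k \<subseteq> gen k' A'" "A \<subseteq> gen k' A'" "k' \<subseteq> gen k A" "A' \<subseteq> gen k A"
  shows "gen k A = gen k' A'"
  using assms by (intro subset_antisym gen_least gen_subfield)

lemma gen_eqD:
  assumes "gen k A = E"
  shows "is_subfield E" "k \<subseteq> E" "A \<subseteq> E"
  unfolding assms[symmetric] by (rule gen_subfield gen_base gen_gens)+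

text \<open>The fields \<open>gen k T\<close> with \<open>T\<close> a finite part of
  \<open>S\<close> are directed, so their union \<open>U\<close> is already a subfield; it contains
  \<open>k\<close> and \<open>S\<close>.\<close>

lemma gen_finite_support:
  assumes "x \<in> gen k S"
  shows "\<exists>T. finite T \<and> T \<subseteq> S \<and> x \<in> gen k T"
proof -
  define U where "U = (\<Union>T\<in>{T. finite T \<and> T \<subseteq> S}. gen k T)"
  have UI: "y \<in> U" if "finite T" "T \<subseteq> S" "y \<in> gen k T" for y T
    using that unfolding U_def by blast
  have two: "\<exists>T. finite T \<and> T \<subseteq> S \<and> y \<in> gen k T \<and> z \<in> gen k T"
    if yz: "y \<in> U" "z \<in> U" for y z
  proof -
    obtain T where T: "finite T" "T \<subseteq> S" "y \<in> gen k T"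
      using yz(1) unfolding U_def by (elim UN_E) auto
    obtain T' where T': "finite T'" "T' \<subseteq> S" "z \<in> gen k T'"
      using yz(2) unfolding U_def by (elim UN_E) auto
    have "y \<in> gen k (T \<union> T')" "z \<in> gen k (T \<union> T')"
      using T(3) T'(3) gen_mono[of k k T "T \<union> T'"] gen_mono[of k k T' "T \<union> T'"] by blast+
    then show ?thesis
      using T T' by (intro exI[of _ "T \<union> T'"]) simp
  qed
  have "is_subfield U"
    unfolding is_subfield_def
  proof (intro conjI ballI)
    show "0 \<in> U" "1 \<in> U" using is_subfieldD(1,2)[OF gen_subfield] by (auto intro!: UI[of "{}"])
    fix y assume y: "y \<in> U"
    obtain T where "finite T" "T \<subseteq> S" "y \<in> gen k T" using two[OF y y] by blast
    then show "inverse y \<in> U" by (intro UI[of T]) (auto intro: is_subfieldD gen_subfield)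
    fix z assume z: "z \<in> U"
    obtain T where "finite T" "T \<subseteq> S" "y \<in> gen k T" "z \<in> gen k T" using two[OF y z] by blast
    then show "y + z \<in> U" "y - z \<in> U" "y * z \<in> U"
      by (auto intro!: UI[of T] intro: is_subfieldD gen_subfield)
  qed
  moreover have "k \<subseteq> U" using gen_base[of k "{}"] by (auto intro: UI[of "{}"])
  moreover have "S \<subseteq> U"
  proof
    fix s assume "s \<in> S"
    then show "s \<in> U" using gen_gens[of "{s}" k] by (auto intro: UI[of "{s}"])
  qed
  ultimately have "gen k S \<subseteq> U" by (rule gen_least)
  with assms have "x \<in> U" by blast
  then show ?thesis using two[of x x] by blast
qed

lemma gen_finite_support_set:
  assumes "finite T" "T \<subseteq> gen k S"
  shows "\<exists>T'. finite T' \<and> T' \<subseteq> S \<and> T \<subseteq> gen k T'"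
  using assms
proof (induction rule: finite_induct)
  case empty
  then show ?case by (intro exI[of _ "{}"]) auto
next
  case (insert x T)
  then obtain A B where "finite A" "A \<subseteq> S" "T \<subseteq> gen k A" "finite B" "B \<subseteq> S" "x \<in> gen k B"
    using gen_finite_support[of x k S] by auto
  then show ?case
    using gen_mono[of k k A "A \<union> B"] gen_mono[of k k B "A \<union> B"]
    by (intro exI[of _ "A \<union> B"]) auto
qed

section \<open>Iterated Frobenius images and exponents\<close>

definition frob :: "nat \<Rightarrow> 'a::field set \<Rightarrow> 'a set" where
  "frob n A = (\<lambda>x. x ^ (CHAR('a) ^ n)) ` A"

text \<open>Allowed for arbitrary sets, so that it can be checked on generators and then carried to
  the generated field by \<open>exponent_le_gen\<close>.\<close>

definition exponent_le :: "nat \<Rightarrow> 'a::field set \<Rightarrow> 'a set \<Rightarrow> bool" where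
  "exponent_le n F E \<longleftrightarrow> frob n E \<subseteq> F"

lemma frob_mono: "A \<subseteq> B \<Longrightarrow> frob n A \<subseteq> frob n B"
  by (auto simp: frob_def)

lemma frob_0: "frob 0 A = A"
  by (simp add: frob_def)

lemma frob_frob: "frob m (frob n A) = frob (n + m) A"
  by (auto simp: frob_def image_image power_mult[symmetric] power_add)

lemma frob_Un: "frob n (A \<union> B) = frob n A \<union> frob n B"
  by (auto simp: frob_def)

lemma frobI:
  fixes x :: "'a::field"
  shows "x \<in> A \<Longrightarrow> x ^ (CHAR('a) ^ n) \<in> frob n A"
  by (auto simp: frob_def)

lemma frob_subset: "is_subfield F \<Longrightarrow> A \<subseteq> F \<Longrightarrow> frob n A \<subseteq> F"
  by (auto simp: frob_def intro: is_subfieldD)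

context
  fixes ty :: "'a::field itself"
  assumes char_pos: "CHAR('a) > 0"
begin

lemma char_prime: "prime CHAR('a)"
  using prime_CHAR_semidom[OF char_pos] .

lemma pow_add:
  fixes x y :: 'a
  shows "(x + y) ^ (CHAR('a) ^ n) = x ^ (CHAR('a) ^ n) + y ^ (CHAR('a) ^ n)"
  using freshmans_dream'[OF char_prime refl, of x y n] by simp

lemma pow_diff:
  fixes x y :: 'a
  shows "(x - y) ^ (CHAR('a) ^ n) = x ^ (CHAR('a) ^ n) - y ^ (CHAR('a) ^ n)"
  using pow_add[of "x - y" y n] by (simp add: algebra_simps)

lemma pow_inj:
  fixes x y :: 'a
  shows "x ^ (CHAR('a) ^ n) = y ^ (CHAR('a) ^ n) \<Longrightarrow> x = y"
  using pow_diff[of x y n] by simp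

lemma pow_0: "(0::'a) ^ (CHAR('a) ^ n) = 0"
  using char_pos by simp

lemma frob_subfield:
  fixes F :: "'a set"
  shows "is_subfield F \<Longrightarrow> is_subfield (frob n F)"
proof -
  assume F: "is_subfield F"
  show ?thesis
      unfolding is_subfield_def
  proof (intro conjI ballI)
    show "0 \<in> frob n F" "1 \<in> frob n F"
      using frobI[OF is_subfieldD(1)[OF F], of n] frobI[OF is_subfieldD(2)[OF F], of n] pow_0[of n] by simp_all
    fix x assume "x \<in> frob n F"
    then obtain u where u: "u \<in> F" "x = u ^ (CHAR('a) ^ n)" by (auto simp: frob_def)
    show "inverse x \<in> frob n F"
      using frobI[OF is_subfieldD(6)[OF F u(1)], of n] by (simp add: u(2) power_inverse)
    fix y assume "y \<in> frob n F"
    then obtain v where v: "v \<in> F" "y = v ^ (CHAR('a) ^ n)" by (auto simp: frob_def)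
    show "x + y \<in> frob n F" "x - y \<in> frob n F" "x * y \<in> frob n F"
      using frobI[OF is_subfieldD(3)[OF F u(1) v(1)], of n] frobI[OF is_subfieldD(4)[OF F u(1) v(1)], of n]
        frobI[OF is_subfieldD(5)[OF F u(1) v(1)], of n]
      by (simp_all add: u(2) v(2) pow_add pow_diff power_mult_distrib)
  qed
qed

lemma root_subfield:
  fixes F :: "'a set"
  shows "is_subfield F \<Longrightarrow> is_subfield {x. x ^ (CHAR('a) ^ n) \<in> F}"
  unfolding is_subfield_def by (auto simp: pow_add pow_diff power_mult_distrib power_inverse[symmetric] pow_0)

text \<open>Frobenius is a field endomorphism, so preimages and images of subfields are subfields;
  each fact gives one inclusion.\<close>

lemma frob_gen:
  fixes k S :: "'a set"
  shows "frob n (gen k S) = gen (frob n k) (frob n S)"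
proof
  let ?F = "{x. x ^ (CHAR('a) ^ n) \<in> gen (frob n k) (frob n S)}"
  have "gen k S \<subseteq> ?F"
    by (rule gen_least[OF root_subfield[OF gen_subfield]])
      (use gen_base[of "frob n k"] gen_gens[of "frob n S"] frobI in blast)+
  then show "frob n (gen k S) \<subseteq> gen (frob n k) (frob n S)"
    by (auto simp: frob_def)
  show "gen (frob n k) (frob n S) \<subseteq> frob n (gen k S)"
    by (intro gen_least frob_subfield gen_subfield frob_mono gen_base gen_gens)
qed

text \<open>Makes the passage from \<open>E\<close> to \<open>k(E^p)\<close> iterable: the result
  depends only on generators of \<open>E\<close> over \<open>k\<close>.\<close>

lemma gen_frob_gen:
  fixes k S :: "'a set"
  shows "is_subfield k \<Longrightarrow> gen k (frob n (gen k S)) = gen k (frob n S)"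
  unfolding frob_gen
  by (intro subset_antisym gen_least gen_subfield gen_base gen_mono)
    (use frob_subset[of k k n] gen_base[of k] gen_gens[of "frob n S"] in blast)+

lemma exponent_le_gen:
  fixes k S :: "'a set"
  shows "is_subfield k \<Longrightarrow> exponent_le n k S \<Longrightarrow> exponent_le n k (gen k S)"
  unfolding exponent_le_def frob_gen using frob_subset[of k k n] by (intro gen_least) auto

lemma exponent_leD:
  fixes x :: 'a
  shows "exponent_le n F E \<Longrightarrow> x \<in> E \<Longrightarrow> x ^ (CHAR('a) ^ n) \<in> F"
  using frobI[of x E n] by (auto simp: exponent_le_def)

lemma exponent_le_mono:
  fixes F E :: "'a set"
  shows "exponent_le m F E \<Longrightarrow> is_subfield F \<Longrightarrow> m \<le> n \<Longrightarrow> exponent_le n F E"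
  using frob_subset[of F "frob m E" "n - m"] by (auto simp: exponent_le_def frob_frob)

lemma finite_exponent:
  fixes F S :: "'a set"
  assumes "is_subfield F" "finite S" "\<And>x. x \<in> S \<Longrightarrow> \<exists>n. x ^ (CHAR('a) ^ n) \<in> F"
  shows "\<exists>n. exponent_le n F S"
  using assms(2,3)
proof (induction rule: finite_induct)
  case empty
  then show ?case by (auto simp: exponent_le_def frob_def)
next
  case (insert x S)
  obtain n where "x ^ (CHAR('a) ^ n) \<in> F" using insert.prems by blast
  moreover obtain m where "exponent_le m F S" using insert by blast
  ultimately have "exponent_le (max m n) F S" "exponent_le (max m n) F {x}"
    using exponent_le_mono[OF _ assms(1), of m S "max m n"]
      exponent_le_mono[OF _ assms(1), of n "{x}" "max m n"]
    by (auto simp: exponent_le_def frob_def)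
  then show ?case by (intro exI[of _ "max m n"]) (auto simp: exponent_le_def frob_def)
qed

text \<open>The identity \<open>E = k(E\<^sup>p, G)\<close> may be substituted into itself, as in Nakayama's lemma.\<close>

lemma gen_frob_iterate:
  fixes k E G :: "'a set"
  assumes "is_subfield k" "E = gen k (frob 1 E \<union> G)"
  shows "E = gen k (frob n E \<union> G)"
proof (induction n)
  case 0
  have "gen k (E \<union> G) = E"
    using gen_eqD[OF assms(2)[symmetric]] by (intro subset_antisym gen_least) (auto intro: gen_gens[THEN subsetD])
  then show ?case by (simp add: frob_0)
next
  case (Suc n)
  let ?H = "gen k (frob (Suc n) E \<union> G)"
  have kH: "k \<subseteq> ?H" and GH: "G \<subseteq> ?H" and fH: "frob (Suc n) E \<subseteq> ?H"
    using gen_base[of k] gen_gens[of "frob (Suc n) E \<union> G" k] by blast+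
  have "frob 1 E = gen (frob 1 k) (frob (Suc n) E \<union> frob 1 G)"
    by (subst Suc) (simp add: frob_gen frob_Un frob_frob)
  also have "\<dots> \<subseteq> ?H"
    by (intro gen_least gen_subfield Un_least frob_subset kH fH GH)
  finally have "E \<subseteq> ?H"
    by (subst assms(2)) (intro gen_least gen_subfield Un_least kH GH)
  moreover have "?H \<subseteq> E"
  proof -
    note E = gen_eqD[OF assms(2)[symmetric]]
    then show ?thesis by (intro gen_least Un_least frob_subset) auto
  qed
  ultimately show ?case by blast
qed

text \<open>Nakayama for bounded exponent: after \<open>n\<close> substitutions the Frobenius part
  has sunk into \<open>k\<close>, so whatever generates \<open>E\<close> over \<open>k(E^p)\<close>
  generates it over \<open>k\<close>.\<close>

lemma gen_of_bounded_exponent: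
  fixes k E G :: "'a set"
  assumes "is_subfield k" "exponent_le n k E" "gen (gen k (frob 1 E)) G = E"
  shows "gen k G = E"
proof -
  have "E = gen k (frob n E \<union> G)"
    by (rule gen_frob_iterate) (use assms in \<open>simp_all add: gen_gen\<close>)
  also have "\<dots> = gen k G"
    using assms(2) gen_base[of k G] gen_gens[of G k] gen_base[of k "frob n E \<union> G"] gen_gens[of "frob n E \<union> G" k]
    by (intro gen_eqI) (auto simp: exponent_le_def)
  finally show ?thesis ..
qed

end

subsection \<open>Degrees of subfield extensions\<close>

text \<open>The whole type as a ring of HOL-Algebra; its theory of bases and dimension then applies
  to subfields given as sets.\<close>

abbreviation type_ring :: "'a::field ring" where
  "type_ring \<equiv> ring_of_type_algebra"

interpretation TR: cring "type_ring :: 'a::field ring"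
  by (rule cring_from_type_algebra)

lemma type_ring_simps [simp]:
  fixes x y :: "'a::field"
  shows
  "carrier (type_ring :: 'a::field ring) = UNIV"
  "x \<otimes>\<^bsub>type_ring\<^esub> y = x * y" "x \<oplus>\<^bsub>type_ring\<^esub> y = x + y"
  "\<zero>\<^bsub>type_ring\<^esub> = (0 :: 'a)" "\<one>\<^bsub>type_ring\<^esub> = (1 :: 'a)"
  by (simp_all add: ring_of_type_algebra_def)

lemma type_ring_uminus [simp]:
  fixes x :: "'a::field"
  shows "\<ominus>\<^bsub>type_ring\<^esub> x = - x"
  by (rule TR.minus_equality) simp_all

lemma type_ring_inv:
  fixes x :: "'a::field"
  shows "x \<noteq> 0 \<Longrightarrow> inv\<^bsub>type_ring\<^esub> x = inverse x"
  by (rule TR.comm_inv_char) simp_all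

lemma subfield_type_ring: "is_subfield F \<Longrightarrow> subfield F type_ring"
  by (rule field.subfieldI'[OF field_from_type_algebra], rule TR.subringI) (auto simp: type_ring_inv is_subfieldD)

declare TR.Span.simps [simp del]

abbreviation indep :: "'a::field set \<Rightarrow> 'a list \<Rightarrow> bool" where
  "indep \<equiv> TR.independent"

abbreviation lspan :: "'a::field set \<Rightarrow> 'a list \<Rightarrow> 'a set" where
  "lspan \<equiv> TR.Span"

definition fin_ext :: "'a::field set \<Rightarrow> 'a set \<Rightarrow> bool" where
  "fin_ext F E \<longleftrightarrow> TR.finite_dimension F E"

definition ext_deg :: "'a::field set \<Rightarrow> 'a set \<Rightarrow> nat" where
  "ext_deg F E = TR.dim F E"

section \<open>Linear combinations, spans and independence\<close>

lemma combine_map: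
  fixes U :: "'a::field list"
  shows "distinct U \<Longrightarrow> TR.combine (map c U) U = (\<Sum>u\<in>set U. c u * u)"
  by (induction U) auto

text \<open>HOL-Algebra combines lists of coefficients, \<open>lin_indep\<close> uses coefficient
  functions; over a distinct list of vectors the two are interchangeable.\<close>

lemma list_as_map:
  assumes "distinct U" "length Ks = length U"
  shows "\<exists>c. Ks = map c U"
proof
  show "Ks = map (\<lambda>u. the (map_of (zip U Ks) u)) U"
    using assms by (intro nth_equalityI) (auto simp: map_of_zip_nth)
qed

lemma lspan_eq:
  fixes U :: "'a::field list"
  assumes F: "is_subfield F" and U: "distinct U"
  shows "lspan F U = {\<Sum>u\<in>set U. c u * u | c. \<forall>u\<in>set U. c u \<in> F}"
proof -
  have "lspan F U = {TR.combine Ks U | Ks. length Ks = length U \<and> set Ks \<subseteq> F}"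
    using TR.Span_eq_combine_set_length_version[OF subfield_type_ring[OF F], of U] by simp
  also have "\<dots> = {TR.combine (map c U) U | c. \<forall>u\<in>set U. c u \<in> F}" (is "?A = ?B")
  proof (intro subset_antisym subsetI)
    fix x assume "x \<in> ?A"
    then obtain Ks where Ks: "x = TR.combine Ks U" "length Ks = length U" "set Ks \<subseteq> F" by blast
    obtain c where c: "Ks = map c U" using list_as_map[OF U Ks(2)] by blast
    have "\<forall>u\<in>set U. c u \<in> F" using Ks(3) unfolding c by auto
    then show "x \<in> ?B" using Ks(1) unfolding c by blast
  next
    fix x assume "x \<in> ?B"
    then obtain c where c: "x = TR.combine (map c U) U" "\<forall>u\<in>set U. c u \<in> F" by blast
    have "length (map c U) = length U \<and> set (map c U) \<subseteq> F" using c(2) by auto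
    then show "x \<in> ?A" using c(1) by blast
  qed
  finally show ?thesis by (simp add: combine_map[OF U])
qed

lemma indep_iff:
  fixes U :: "'a::field list"
  assumes F: "is_subfield F"
  shows "indep F U \<longleftrightarrow> distinct U \<and> lin_indep F (set U)"
proof
  assume ind: "indep F U"
  then have d: "distinct U" using TR.independent_distinct[OF subfield_type_ring[OF F]] by blast
  have "c s = 0" if T: "finite T" "T \<subseteq> set U" "\<forall>s\<in>T. c s \<in> F" "(\<Sum>s\<in>T. c s * s) = 0" "s \<in> T" for T c s
  proof -
    \<comment> \<open>Coefficients on a part of \<open>U\<close> are padded by zero, because
      \<open>indep\<close> speaks of combinations of the whole list.\<close>
    define c' where "c' u = (if u \<in> T then c u else 0)" for u
    have "(\<Sum>u\<in>set U. c' u * u) = (\<Sum>u\<in>T. c' u * u)"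
      by (rule sum.mono_neutral_right) (use T in \<open>auto simp: c'_def\<close>)
    also have "\<dots> = (\<Sum>u\<in>T. c u * u)" by (rule sum.cong) (auto simp: c'_def)
    finally have "TR.combine (map c' U) U = 0" using T(4) by (simp add: combine_map[OF d])
    moreover have "set (map c' U) \<subseteq> F" using T is_subfieldD(1)[OF F] by (auto simp: c'_def)
    ultimately have "set (take (length U) (map c' U)) \<subseteq> {0}"
      using TR.independent_imp_trivial_combine[OF subfield_type_ring[OF F] ind, of "map c' U"]
      by (simp only: type_ring_simps)
    moreover have "take (length U) (map c' U) = map c' U" by simp
    ultimately have "c' s = 0" using T(2,5) by auto
    then show ?thesis using T(5) by (simp add: c'_def)
  qed
  with d show "distinct U \<and> lin_indep F (set U)" unfolding lin_indep_def by blast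
next
  assume U: "distinct U \<and> lin_indep F (set U)"
  show "indep F U"
  proof (rule ccontr)
    assume "\<not> indep F U"
    then obtain Ks where Ks: "length Ks = length U" "TR.combine Ks U = 0" "set Ks \<subseteq> F" "set Ks \<noteq> {0}"
      using TR.dependent_imp_non_trivial_combine[OF subfield_type_ring[OF F], of U] by auto
    obtain c where c: "Ks = map c U" using list_as_map[OF _ Ks(1)] U by blast
    have "\<forall>s\<in>set U. c s \<in> F" "(\<Sum>s\<in>set U. c s * s) = 0"
      using Ks(2,3) U by (auto simp: c combine_map)
    moreover have "finite (set U) \<and> set U \<subseteq> set U" by simp
    ultimately have "\<forall>u\<in>set U. c u = 0"
      using U unfolding lin_indep_def by blast
    then have "set Ks \<subseteq> {0}" by (auto simp: c)
    \<comment> \<open>With all coefficients zero, \<open>set Ks \<noteq> {0}\<close> leaves only the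
      empty list, and that one is independent.\<close>
    then have "U = []" using Ks(1,4) by (cases Ks) auto
    then show False using \<open>\<not> indep F U\<close> by auto
  qed
qed

lemma lin_indep_mono: "lin_indep F S \<Longrightarrow> T \<subseteq> S \<Longrightarrow> lin_indep F T"
  unfolding lin_indep_def by (meson subset_trans)

lemma lspanI: "is_subfield F \<Longrightarrow> set U \<subseteq> lspan F U"
  using TR.Span_base_incl[OF subfield_type_ring] by auto

lemma lspan_closed:
  assumes "is_subfield F"
  shows "0 \<in> lspan F U" "x \<in> lspan F U \<Longrightarrow> y \<in> lspan F U \<Longrightarrow> x + y \<in> lspan F U"
    "c \<in> F \<Longrightarrow> x \<in> lspan F U \<Longrightarrow> c * x \<in> lspan F U" "x \<in> lspan F U \<Longrightarrow> - x \<in> lspan F U"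
  using TR.Span_subgroup_props[OF subfield_type_ring[OF assms], of U]
    TR.Span_smult_closed[OF subfield_type_ring[OF assms], of U] by auto

lemma subalgebraI:
  fixes V :: "'a::field set"
  assumes "is_subfield F" "0 \<in> V" "\<And>x y. x \<in> V \<Longrightarrow> y \<in> V \<Longrightarrow> x + y \<in> V"
    "\<And>c x. c \<in> F \<Longrightarrow> x \<in> V \<Longrightarrow> c * x \<in> V"
  shows "subalgebra F V type_ring"
proof (rule subalgebra.intro)
  have "- x \<in> V" if "x \<in> V" for x
    using assms(4)[OF is_subfieldD(7)[OF assms(1) is_subfieldD(2)[OF assms(1)]] that] by simp
  then have "\<ominus>\<^bsub>type_ring\<^esub> x \<in> V" if "x \<in> V" for x using that by simp
  then show "subgroup V (add_monoid type_ring)"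
    using assms(2,3) by (intro TR.add.subgroupI) auto
qed (use assms in \<open>auto simp: subalgebra_axioms_def\<close>)

text \<open>Serves as induction over a span: \<open>V\<close> is taken to be the set of elements
  with the property in question.\<close>

lemma lspan_least:
  fixes V :: "'a::field set"
  assumes "is_subfield F" "set U \<subseteq> V" "0 \<in> V" "\<And>x y. x \<in> V \<Longrightarrow> y \<in> V \<Longrightarrow> x + y \<in> V"
    "\<And>c x. c \<in> F \<Longrightarrow> x \<in> V \<Longrightarrow> c * x \<in> V"
  shows "lspan F U \<subseteq> V"
  using TR.subalgebra_Span_incl[OF subfield_type_ring[OF assms(1)] subalgebraI[OF assms(1,3-5)] assms(2)] .

section \<open>Bases and degrees of finite extensions\<close>

lemma fin_ext_basis:
  assumes "is_subfield F" "fin_ext F E"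
  obtains U where "indep F U" "lspan F U = E" "length U = ext_deg F E"
proof -
  have "TR.dimension (ext_deg F E) F E"
    using TR.finite_dimensionE[OF subfield_type_ring[OF assms(1)]] assms(2)
    by (simp add: fin_ext_def ext_deg_def over_def)
  then show ?thesis using TR.exists_base[OF subfield_type_ring[OF assms(1)]] that by blast
qed

lemma fin_extI:
  assumes "is_subfield F" "indep F U" "lspan F U = E"
  shows "fin_ext F E" "ext_deg F E = length U"
  using TR.dimensionI[OF subfield_type_ring[OF assms(1)] assms(2,3)]
    TR.finite_dimensionI TR.dimI[OF subfield_type_ring[OF assms(1)]]
  by (auto simp: fin_ext_def ext_deg_def over_def)

text \<open>Every vector in the span of the later ones is dropped; if the length has not changed,
  nothing was dropped and the list was independent.\<close>

lemma dependent_shrink: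
  assumes F: "is_subfield F"
  shows "\<exists>V. indep F V \<and> lspan F V = lspan F U \<and> length V \<le> length U \<and>
           (length V = length U \<longrightarrow> indep F U)"
proof (induction U)
  case Nil
  then show ?case by auto
next
  case (Cons u U)
  then obtain V where V: "indep F V" "lspan F V = lspan F U" "length V \<le> length U"
    "length V = length U \<longrightarrow> indep F U" by blast
  show ?case
  proof (cases "u \<in> lspan F U")
    case True
    have "lspan F (u # U) = lspan F U"
    proof (rule subset_antisym)
      show "lspan F (u # U) \<subseteq> lspan F U"
        by (rule lspan_least[OF F]) (use True lspanI[OF F, of U] lspan_closed[OF F, where U = U] in auto)
      show "lspan F U \<subseteq> lspan F (u # U)"
        by (rule lspan_least[OF F]) (use lspanI[OF F, of "u # U"] lspan_closed[OF F, where U = "u # U"] in auto)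
    qed
    then show ?thesis using V by (intro exI[of _ V]) auto
  next
    case False
    then have "indep F (u # V)" using V(1,2) by (simp add: TR.independent.li_Cons)
    moreover have "length V = length U \<longrightarrow> indep F (u # U)"
      using False V(4) by (simp add: TR.independent.li_Cons)
    moreover have "lspan F (u # V) = lspan F (u # U)"
      using V(2) by (simp add: TR.Span.simps)
    ultimately show ?thesis using V(3) by (intro exI[of _ "u # V"]) simp
  qed
qed

lemma fin_ext_span:
  assumes "is_subfield F" "lspan F U = E"
  shows "fin_ext F E" "ext_deg F E \<le> length U" "ext_deg F E = length U \<Longrightarrow> indep F U"
proof -
  obtain V where V: "indep F V" "lspan F V = lspan F U" "length V \<le> length U"
    "length V = length U \<longrightarrow> indep F U" using dependent_shrink[OF assms(1)] by blast
  with fin_extI[OF assms(1) V(1), of E] assms(2)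
  show "fin_ext F E" "ext_deg F E \<le> length U" "ext_deg F E = length U \<Longrightarrow> indep F U" by auto
qed

lemma fin_ext_extend:
  assumes "is_subfield F" "fin_ext F E" "finite T" "T \<subseteq> E" "lin_indep F T"
  obtains U where "indep F U" "lspan F U = E" "T \<subseteq> set U" "length U = ext_deg F E"
proof -
  obtain W where W: "set W = T" "distinct W" using finite_distinct_list[OF assms(3)] by blast
  have "indep F W" using indep_iff[OF assms(1), of W] W assms(5) by simp
  moreover have "TR.dimension (ext_deg F E) F E"
    using TR.finite_dimensionE[OF subfield_type_ring[OF assms(1)]] assms(2)
    by (simp add: fin_ext_def ext_deg_def over_def)
  ultimately obtain V where "length (V @ W) = ext_deg F E" "indep F (V @ W)" "lspan F (V @ W) = E"
    using TR.complete_base[OF subfield_type_ring[OF assms(1)], of "ext_deg F E" E W] W assms(4) by blast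
  then show ?thesis using that[of "V @ W"] W by auto
qed

lemma fin_ext_trans:
  assumes "is_subfield F" "is_subfield E" "fin_ext F E" "fin_ext E M"
  shows "fin_ext F M" "ext_deg F M = ext_deg F E * ext_deg E M"
  using TR.telescopic_base_dim[OF assms(1,2)[THEN subfield_type_ring]] assms(3,4)
  by (auto simp: fin_ext_def ext_deg_def over_def)

lemma subfield_subalgebra: "is_subfield F \<Longrightarrow> is_subfield E \<Longrightarrow> F \<subseteq> E \<Longrightarrow> subalgebra F E type_ring"
  by (intro subalgebraI) (auto intro: is_subfieldD)

lemma fin_ext_refl: "is_subfield F \<Longrightarrow> fin_ext F F" "is_subfield F \<Longrightarrow> ext_deg F F = 1"
  using TR.dimension_one[OF subfield_type_ring, of F] TR.finite_dimensionI TR.dimI[OF subfield_type_ring, of F 1 F]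
  by (auto simp: fin_ext_def ext_deg_def over_def)

context
  fixes F E M :: "'a::field set"
  assumes F: "is_subfield F" and E: "is_subfield E" and M: "is_subfield M"
    and FE: "F \<subseteq> E" and EM: "E \<subseteq> M" and fin: "fin_ext F M"
begin

lemma fin_ext_lower: "fin_ext F E"
  using TR.subalbegra_incl_imp_finite_dimension[OF subfield_type_ring[OF F] _ subfield_subalgebra[OF F E FE] EM] fin
  by (simp add: fin_ext_def)

lemma fin_ext_upper: "fin_ext E M"
proof -
  obtain U where U: "lspan F U = M" using fin_ext_basis[OF F fin] by blast
  have UM: "set U \<subseteq> M" using lspanI[OF F, of U] U by simp
  have "lspan E U = M"
  proof (rule subset_antisym)
    show "lspan E U \<subseteq> M"
      by (rule lspan_least[OF E]) (use EM UM in \<open>auto intro: is_subfieldD(1,3,5)[OF M]\<close>)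
    show "M \<subseteq> lspan E U" unfolding U[symmetric]
      by (rule lspan_least[OF F]) (use FE lspanI[OF E, of U] in \<open>auto intro: lspan_closed[OF E]\<close>)
  qed
  then show ?thesis using fin_ext_span(1)[OF E] by blast
qed

lemma ext_deg_mult: "ext_deg F M = ext_deg F E * ext_deg E M"
  using fin_ext_trans(2)[OF F E fin_ext_lower fin_ext_upper] .

end

lemma ext_deg_pos:
  assumes "is_subfield F" "is_subfield E" "F \<subseteq> E" "fin_ext F E"
  shows "ext_deg F E > 0"
proof (rule ccontr)
  assume "\<not> ext_deg F E > 0"
  with fin_ext_basis[OF assms(1,4)] have "lspan F [] = E" by (metis length_0_conv not_gr0)
  then have "E = {0}" by (simp add: TR.Span.simps)
  then show False using is_subfieldD(2)[OF assms(2)] by auto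
qed

text \<open>The independent set \<open>{1}\<close> extends to a basis, which by its length is
  \<open>[1]\<close>.\<close>

lemma ext_deg_eq_1:
  assumes "is_subfield F" "is_subfield E" "F \<subseteq> E" "fin_ext F E" "ext_deg F E = 1"
  shows "E = F"
proof -
  have "lin_indep F {1}" by (auto simp: lin_indep_def subset_singleton_iff)
  then obtain U where U: "indep F U" "lspan F U = E" "{1} \<subseteq> set U" "length U = 1"
    using fin_ext_extend[OF assms(1,4), of "{1}"] is_subfieldD(2)[OF assms(2)] assms(5) by auto
  then have "U = [1]" by (cases U) auto
  have "E \<subseteq> F" unfolding U(2)[symmetric] \<open>U = [1]\<close>
    by (rule lspan_least[OF assms(1)]) (auto intro: is_subfieldD[OF assms(1)])
  then show ?thesis using assms(3) by blast
qed

text \<open>Multiplicativity forces \<open>[M : E] = 1\<close>. Chains of fields are later seen to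
  stabilise by choosing a member of extremal degree.\<close>

lemma ext_deg_le_imp_eq:
  assumes "is_subfield F" "is_subfield E" "is_subfield M" "F \<subseteq> E" "E \<subseteq> M" "fin_ext F M" "ext_deg F M \<le> ext_deg F E"
  shows "E = M"
proof -
  note * = assms(1-6)
  have "ext_deg F E > 0" using ext_deg_pos fin_ext_lower[OF *] assms by blast
  then have "ext_deg E M \<le> 1" using ext_deg_mult[OF *] assms(7) by (metis less_numeral_extra(3) linorder_not_less mult.commute mult_cancel2 mult_le_cancel1 mult.right_neutral nat_mult_le_cancel_disj)
  moreover have "ext_deg E M > 0" using ext_deg_pos[OF assms(2,3,5) fin_ext_upper[OF *]] .
  ultimately show ?thesis using ext_deg_eq_1[OF assms(2,3,5) fin_ext_upper[OF *]] by simp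
qed

lemma fin_ext_imp_finite_ext:
  assumes "is_subfield F" "is_subfield E" "fin_ext F E"
  shows "finite_ext F E"
proof -
  obtain U where U: "indep F U" "lspan F U = E" using fin_ext_basis[OF assms(1,3)] by blast
  have d: "distinct U" using indep_iff[OF assms(1)] U(1) by blast
  show ?thesis unfolding finite_ext_def
    using lspan_eq[OF assms(1) d] lspanI[OF assms(1), of U] U(2)
    by (intro exI[of _ "set U"]) blast
qed

section \<open>Frobenius images and base change of finite extensions\<close>

context
  fixes ty :: "'a::field itself"
  assumes char_pos: "CHAR('a) > 0"
begin

text \<open>Frobenius is an injective ring homomorphism and so preserves dimension, provided the
  base field is moved along.\<close>

lemma frob_fin_ext:
  fixes F E :: "'a set"
  assumes F: "is_subfield F" and fin: "fin_ext F E"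
  shows "fin_ext (frob n F) (frob n E)" "ext_deg (frob n F) (frob n E) = ext_deg F E"
proof -
  let ?h = "\<lambda>x::'a. x ^ (CHAR('a) ^ n)"
  interpret h: ring_hom_ring type_ring type_ring ?h
    by (rule ring_hom_ringI)
      (auto simp: power_mult_distrib pow_add[OF char_pos] intro: TR.ring_axioms)
  have "TR.dimension (ext_deg F E) F E"
    using TR.finite_dimensionE[OF subfield_type_ring[OF F]] fin
    by (simp add: fin_ext_def ext_deg_def over_def)
  then have "TR.dimension (ext_deg F E) (?h ` F) (?h ` E)"
    by (intro h.inj_hom_dimension subfield_type_ring F) (auto intro: inj_onI pow_inj[OF char_pos])
  then show "fin_ext (frob n F) (frob n E)" "ext_deg (frob n F) (frob n E) = ext_deg F E"
    using TR.finite_dimensionI TR.dimI[OF subfield_type_ring[OF frob_subfield[OF char_pos F]]]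
    unfolding frob_def by (auto simp: fin_ext_def ext_deg_def over_def)
qed

text \<open>Inverses come for free: \<open>1/x\<close> is \<open>x^(p^n - 1)\<close> divided by
  \<open>x^(p^n)\<close>, and the denominator lies in \<open>F\<close>.\<close>

lemma subfield_of_purely_inseparable:
  fixes F V :: "'a set"
  assumes F: "is_subfield F" "F \<subseteq> V" and V: "\<And>x y. x \<in> V \<Longrightarrow> y \<in> V \<Longrightarrow> x + y \<in> V"
    "\<And>x y. x \<in> V \<Longrightarrow> y \<in> V \<Longrightarrow> x * y \<in> V"
    and pi: "\<And>x. x \<in> V \<Longrightarrow> \<exists>n. x ^ (CHAR('a) ^ n) \<in> F"
  shows "is_subfield V"
proof -
  have m: "- x \<in> V" if "x \<in> V" for x
    using V(2)[of "- 1" x] F is_subfieldD(2,7) that by (metis minus_mult_minus mult_1 mult_minus_left subsetD)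
  have pow: "x ^ n \<in> V" if "x \<in> V" for x n
    using that V(2) F(2) is_subfieldD(2)[OF F(1)] by (induction n) auto
  have "inverse x \<in> V" if x: "x \<in> V" "x \<noteq> 0" for x
  proof -
    obtain n where n: "x ^ (CHAR('a) ^ n) \<in> F" using pi[OF x(1)] by blast
    have "inverse (x ^ (CHAR('a) ^ n)) * x ^ (CHAR('a) ^ n - 1) \<in> V"
      using V(2) pow[OF x(1)] is_subfieldD(6)[OF F(1) n] F(2) by blast
    moreover have "x ^ (CHAR('a) ^ n) = x * x ^ (CHAR('a) ^ n - 1)"
      using char_pos by (simp flip: power_Suc)
    ultimately show ?thesis using x(2) by (simp add: field_simps)
  qed
  moreover have "inverse (0::'a) \<in> V" using F is_subfieldD(1) by auto
  ultimately show ?thesis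
    unfolding is_subfield_def using F(2) is_subfieldD(1,2)[OF F(1)] V m
    by (metis subsetD diff_conv_add_uminus)
qed

text \<open>Base change of a basis of \<open>E/F\<close> to \<open>F'\<close>: it still spans the compositum, and it stays
  independent as soon as the degree does not drop.\<close>

lemma base_change_span:
  fixes F F' E :: "'a set"
  assumes F: "is_subfield F" and F': "is_subfield F'" and E: "is_subfield E"
    and FF': "F \<subseteq> F'" and FE: "F \<subseteq> E" and pi: "exponent_le n F E" and U: "lspan F U = E"
  shows "lspan F' U = gen F' E"
proof (rule subset_antisym)
  let ?V = "lspan F' U"
  have UE: "set U \<subseteq> E" using lspanI[OF F, of U] U by simp
  note g = is_subfieldD[OF gen_subfield[of F' E]]
  show "?V \<subseteq> gen F' E"
    by (rule lspan_least[OF F']) (use UE gen_gens[of E F'] gen_base[of F' E] in \<open>auto intro: g(1,3,5)\<close>)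
  note cl = lspan_closed[OF F', where U = U]
  have EV: "E \<subseteq> ?V" unfolding U[symmetric]
    by (rule lspan_least[OF F]) (use FF' lspanI[OF F', of U] in \<open>auto intro: cl\<close>)
  have F'V: "F' \<subseteq> ?V"
  proof
    fix x assume "x \<in> F'"
    then show "x \<in> ?V" using cl(3)[of x 1] EV is_subfieldD(2)[OF E] by auto
  qed
  \<comment> \<open>Closure under products is obtained one factor at a time: both factors in
    \<open>E\<close>, then only the second, then neither.\<close>
  have 1: "u * v \<in> ?V" if "u \<in> E" "v \<in> E" for u v using EV that is_subfieldD(5)[OF E] by blast
  have 2: "x * v \<in> ?V" if "x \<in> ?V" "v \<in> E" for x v
  proof -
    have "?V \<subseteq> {x. x * v \<in> ?V}"
      by (rule lspan_least[OF F']) (use UE 1 that(2) cl in \<open>auto simp: algebra_simps\<close>)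
    then show ?thesis using that(1) by blast
  qed
  have 3: "x * y \<in> ?V" if "x \<in> ?V" "y \<in> ?V" for x y
  proof -
    have "?V \<subseteq> {y. x * y \<in> ?V}"
      by (rule lspan_least[OF F']) (use UE 2[OF that(1)] cl in \<open>auto simp: algebra_simps\<close>)
    then show ?thesis using that(2) by blast
  qed
  have root: "is_subfield {x. x ^ (CHAR('a) ^ n) \<in> F'}" by (rule root_subfield[OF char_pos F'])
  have "?V \<subseteq> {x. x ^ (CHAR('a) ^ n) \<in> F'}"
  proof (rule lspan_least[OF F'])
    show "set U \<subseteq> {x. x ^ (CHAR('a) ^ n) \<in> F'}"
      using UE exponent_leD[OF char_pos pi] FF' by auto
    fix c x assume "c \<in> F'" "x \<in> {x. x ^ (CHAR('a) ^ n) \<in> F'}"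
    then show "c * x \<in> {x. x ^ (CHAR('a) ^ n) \<in> F'}"
      by (auto simp: power_mult_distrib intro: is_subfieldD[OF F'])
  qed (use is_subfieldD(1,3)[OF root] in auto)
  then have "is_subfield ?V"
    by (intro subfield_of_purely_inseparable[OF F' F'V cl(2) 3]) auto
  then show "gen F' E \<subseteq> ?V" by (intro gen_least F'V EV)
qed

context
  fixes F F' E :: "'a set" and n
  assumes F: "is_subfield F" and F': "is_subfield F'" and E: "is_subfield E"
    and FF': "F \<subseteq> F'" and FE: "F \<subseteq> E" and pi: "exponent_le n F E" and fin: "fin_ext F E"
begin

lemma base_change: "fin_ext F' (gen F' E)" "ext_deg F' (gen F' E) \<le> ext_deg F E"
proof -
  obtain U where U: "lspan F U = E" "length U = ext_deg F E" using fin_ext_basis[OF F fin] by blast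
  have "lspan F' U = gen F' E" using base_change_span[OF F F' E FF' FE pi U(1)] .
  then show "fin_ext F' (gen F' E)" "ext_deg F' (gen F' E) \<le> ext_deg F E"
    using fin_ext_span(1,2)[OF F'] U(2) by metis+
qed

text \<open>Turns linear disjointness, the condition in \<open>modular\<close>, into a comparison of
  degrees; both nontrivial proofs of modularity below end here. \<open>T\<close> is completed to a
  basis of \<open>E\<close>, which after base change is a spanning list of minimal length.\<close>

lemma base_change_indep:
  assumes "ext_deg F E \<le> ext_deg F' (gen F' E)" "finite T" "T \<subseteq> E" "lin_indep F T"
  shows "lin_indep F' T"
proof -
  obtain U where U: "lspan F U = E" "T \<subseteq> set U" "length U = ext_deg F E"
    using fin_ext_extend[OF F fin assms(2-4)] by metis
  have *: "lspan F' U = gen F' E" using base_change_span[OF F F' E FF' FE pi U(1)] .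
  have "indep F' U" using fin_ext_span(3)[OF F' *] base_change(2) assms(1) U(3) by simp
  then show ?thesis using indep_iff[OF F'] lin_indep_mono U(2) by blast
qed

end

end

subsection \<open>Degrees of purely inseparable extensions\<close>

context
  fixes ty :: "'a::field itself"
  assumes char_pos: "CHAR('a) > 0"
begin

lemma CHAR_poly: "CHAR('a poly) = CHAR('a)"
  by (rule CHAR_eqI) (simp_all add: of_nat_poly of_nat_eq_0_iff_char_dvd)

text \<open>Shows that \<open>(X - x)^p\<close> has coefficients in every subfield that contains
  \<open>x^p\<close>.\<close>

lemma linear_power_char:
  fixes x :: 'a
  shows "[:- x, 1:] ^ CHAR('a) = monom 1 (CHAR('a)) + [:(- x) ^ CHAR('a):]"
proof -
  have "([:0, 1:] + [:- x:]) ^ CHAR('a) = [:0, 1:] ^ CHAR('a) + [:- x:] ^ CHAR('a)"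
    by (rule freshmans_dream) (simp_all add: CHAR_poly char_prime[OF char_pos])
  then show ?thesis by (simp add: monom_altdef poly_const_pow)
qed

text \<open>A relation \<open>g\<close> of minimal degree divides \<open>(X - x)\<^sup>p\<close>, so it is a power of \<open>X - x\<close>; its
  derivative is a shorter relation unless \<open>g\<close> is linear.\<close>

lemma no_short_relation:
  fixes F :: "'a set"
  assumes F: "is_subfield F" and x: "x \<notin> F" "x ^ CHAR('a) \<in> F"
    and f: "\<And>n. coeff f n \<in> F" "poly f x = 0" "degree f < CHAR('a)"
  shows "f = 0"
proof (rule ccontr)
  assume "f \<noteq> 0"
  define P where "P g \<longleftrightarrow> g \<noteq> 0 \<and> (\<forall>n. coeff g n \<in> F) \<and> poly g x = 0" for g
  have "P f" using f \<open>f \<noteq> 0\<close> by (simp add: P_def)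
  then obtain g where g: "P g" and g_min: "\<And>h. P h \<Longrightarrow> degree g \<le> degree h"
    using ex_has_least_nat[of P f degree] by blast
  have gF: "coeff g n \<in> F" for n using g by (simp add: P_def)
  have g0: "g \<noteq> 0" "poly g x = 0" using g by (auto simp: P_def)
  have "degree g \<le> degree f" using g_min[OF \<open>P f\<close>] .
  then have g_lt: "degree g < CHAR('a)" using f(3) by simp
  have g_pos: "degree g > 0"
  proof (rule ccontr)
    assume "\<not> degree g > 0"
    then obtain c where "g = [:c:]" using degree_eq_zeroE by blast
    then show False using g0 by simp
  qed
  \<comment> \<open>Division over \<open>F\<close>, one leading term at a time; minimality of
    \<open>degree g\<close> lets it run until nothing is left.\<close>
  have dvd: "g dvd h" if "\<And>n. coeff h n \<in> F" "poly h x = 0" for h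
    using that
  proof (induction "degree h" arbitrary: h rule: less_induct)
    case less
    show ?case
    proof (cases "h = 0")
      case False
      then have le: "degree g \<le> degree h" using g_min[of h] less.prems by (simp add: P_def)
      define q where "q = monom (lead_coeff h / lead_coeff g) (degree h - degree g)"
      define h' where "h' = h - q * g"
      have "degree (q * g) \<le> degree h"
        using degree_mult_le[of q g] degree_monom_le[of "lead_coeff h / lead_coeff g" "degree h - degree g"] le
        by (simp add: q_def)
      then have le': "degree h' \<le> degree h" by (simp add: h'_def degree_diff_le)
      have lead: "coeff h' (degree h) = 0"
        using le g0(1) by (simp add: h'_def q_def coeff_monom_mult)
      have cF: "coeff h' n \<in> F" for n
        using less.prems(1) gF is_subfieldD[OF F] by (simp add: h'_def q_def coeff_monom_mult)
      have px: "poly h' x = 0" using less.prems(2) g0(2) by (simp add: h'_def)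
      have "g dvd h'"
      proof (cases "h' = 0")
        case False
        then have "degree h' < degree h" using degree_less_if_less_eqI[OF le' lead] by simp
        then show ?thesis using less.hyps cF px by blast
      qed simp
      then have "g dvd h' + q * g" by (intro dvd_add) simp_all
      then show ?thesis by (simp add: h'_def)
    qed simp
  qed
  let ?X = "[:- x, 1:]"
  have mx: "(- x) ^ CHAR('a) \<in> F"
  proof -
    have "(- x) ^ CHAR('a) = (- 1) ^ CHAR('a) * x ^ CHAR('a)" by (rule power_minus)
    then show ?thesis using x(2) is_subfieldD[OF F] by simp
  qed
  have "g dvd ?X ^ CHAR('a)"
  proof (rule dvd)
    show "coeff (?X ^ CHAR('a)) n \<in> F" for n
      unfolding linear_power_char using mx is_subfieldD(1,2,3)[OF F]
      by (auto simp: coeff_pCons split: nat.split)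
    show "poly (?X ^ CHAR('a)) x = 0" using char_pos by simp
  qed
  then obtain k where k: "?X ^ CHAR('a) = g * k" by (elim dvdE)
  have gk: "g * k \<noteq> 0" using k by (metis power_not_zero pCons_eq_0_iff one_neq_zero)
  \<comment> \<open>In each factor the order at \<open>x\<close> is at most the degree, and both
    sums equal \<open>p\<close>, so equality holds in each.\<close>
  have "order x g + order x k = CHAR('a)"
    using order_power_n_n[of x "CHAR('a)"] order_mult[OF gk, of x] k by simp
  moreover have "degree g + degree k = CHAR('a)"
    using degree_linear_power[of "- x" "CHAR('a)"] degree_mult_eq[of g k] gk k by simp
  moreover have "order x g \<le> degree g" "order x k \<le> degree k"
    using order_degree gk by auto
  ultimately have ord: "order x g = degree g" by linarith
  \<comment> \<open>The leading coefficient of \<open>g\<close> gets multiplied by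
    \<open>degree g\<close>, which is nonzero in the field because
    \<open>0 < degree g < p\<close>.\<close>
  have cg: "coeff (pderiv g) (degree g - 1) \<noteq> 0"
    using g_pos g_lt g0(1) by (simp add: coeff_pderiv of_nat_eq_0_iff_char_dvd nat_dvd_not_less)
  have ofn: "of_nat n \<in> F" for n by (induction n) (auto intro: is_subfieldD[OF F])
  have "poly (pderiv g) x \<noteq> 0"
  proof
    assume "poly (pderiv g) x = 0"
    moreover have "coeff (pderiv g) n \<in> F" for n
      unfolding coeff_pderiv by (intro is_subfieldD(5)[OF F] ofn gF)
    ultimately have "P (pderiv g)" using cg by (auto simp: P_def)
    moreover have "degree (pderiv g) < degree g"
    proof -
      have "degree (pderiv g) \<le> degree g - 1"
        by (rule degree_le) (simp add: coeff_pderiv coeff_eq_0)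
      then show ?thesis using g_pos by simp
    qed
    ultimately show False using g_min[of "pderiv g"] by simp
  qed
  moreover have "poly (pderiv g) x = 0" if deg2: "degree g \<ge> 2"
  proof -
    have "?X ^ 2 dvd g" using ord deg2 by (simp add: order_divides)
    then obtain m where m: "g = ?X ^ 2 * m" by (elim dvdE)
    have "pderiv g = ?X ^ 2 * pderiv m + m * pderiv (?X ^ 2)" unfolding m by (rule pderiv_mult)
    then show ?thesis by (simp add: pderiv_power)
  qed
  ultimately have "degree g = 1" using g_pos by linarith
  obtain a q where q: "g = pCons a q" by (cases g)
  with \<open>degree g = 1\<close> have "degree q = 0" "q \<noteq> 0" by (auto split: if_splits)
  then obtain b where ab: "g = [:a, b:]" "b \<noteq> 0" using q degree_eq_zeroE by (metis pCons_0_0)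
  have "a = coeff g 0" "b = coeff g 1" by (simp_all add: ab)
  then have "a \<in> F" "b \<in> F" using gF by simp_all
  moreover have "x = - a / b" using g0(2) ab by (simp add: field_simps add_eq_0_iff)
  moreover have "- a / b \<in> F" using calculation(1,2) by (intro is_subfieldD(9)[OF F] is_subfieldD(7)[OF F])
  ultimately show False using x(1) by simp
qed

text \<open>Reads a combination of powers of \<open>x\<close> as a polynomial value. The factor
  \<open>y\<close> absorbs the shift by \<open>x\<close> in the induction; it is used with
  \<open>y = 1\<close>.\<close>

lemma combine_powers:
  fixes x y :: 'a
  shows "TR.combine Ks (map (\<lambda>i. x ^ i * y) [0..<length Ks]) = poly (Poly Ks) x * y"
proof (induction Ks arbitrary: y)
  case (Cons c Ks)
  have "map (\<lambda>i. x ^ i * y) [0..<length (c # Ks)] = y # map (\<lambda>i. x ^ i * (x * y)) [0..<length Ks]"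
    unfolding length_Cons upt_conv_Cons[OF zero_less_Suc] map_Suc_upt[symmetric]
    by (simp add: mult_ac)
  then show ?case using Cons[of "x * y"] by (simp add: algebra_simps)
qed simp

text \<open>The powers \<open>x^i\<close> with \<open>i < p\<close> form a basis: a dependence would
  be a short relation, and their span is closed under multiplication because \<open>x^p\<close>
  wraps around into \<open>F\<close>.\<close>

lemma adjoin_root:
  fixes F :: "'a set"
  assumes F: "is_subfield F" and x: "x \<notin> F" "x ^ CHAR('a) \<in> F"
  shows "fin_ext F (gen F {x})" "ext_deg F (gen F {x}) = CHAR('a)"
proof -
  let ?p = "CHAR('a)"
  define U where "U = map (\<lambda>i. x ^ i) [0..<?p]"
  let ?V = "lspan F U"
  have ind: "indep F U"
  proof (rule ccontr)
    assume "\<not> indep F U"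
    then obtain Ks where Ks: "length Ks = length U" "TR.combine Ks U = 0" "set Ks \<subseteq> F" "set Ks \<noteq> {0}"
      using TR.dependent_imp_non_trivial_combine[OF subfield_type_ring[OF F], of U] by auto
    have len: "length Ks = ?p" using Ks(1) by (simp add: U_def)
    have "Poly Ks = 0"
    proof (rule no_short_relation[OF F x])
      show "coeff (Poly Ks) n \<in> F" for n
        using Ks(3) is_subfieldD(1)[OF F] by (auto simp: nth_default_def)
      show "poly (Poly Ks) x = 0" using combine_powers[of Ks x 1] Ks(2) by (simp add: len U_def)
      show "degree (Poly Ks) < ?p"
        using degree_Poly[of Ks] len char_pos coeff_Poly_eq[of Ks]
        by (metis degree_0 leading_coeff_0_iff le_neq_implies_less nth_default_beyond order_refl)
    qed
    then have "set Ks \<subseteq> {0}" by (auto simp: Poly_eq_0)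
    then show False using Ks(4) len char_pos by (cases Ks) auto
  qed
  note cl = lspan_closed[OF F, where U = U]
  have UI: "x ^ i \<in> ?V" if "i < ?p" for i using lspanI[OF F, of U] that by (auto simp: U_def)
  have one: "1 \<in> ?V" using UI[of 0] char_pos by simp
  have FV: "F \<subseteq> ?V" using cl(3)[OF _ one] by auto
  have x1: "x * v \<in> ?V" if "v \<in> ?V" for v
  proof -
    have "x * x ^ i \<in> ?V" if "i < ?p" for i
    proof (cases "Suc i < ?p")
      case True
      then show ?thesis using UI[of "Suc i"] by simp
    next
      case False
      then have "x * x ^ i = x ^ ?p" using that by (metis Suc_lessI power_Suc)
      then show ?thesis using x(2) FV by auto
    qed
    then have "set U \<subseteq> {v. x * v \<in> ?V}" by (auto simp: U_def)
    then have "?V \<subseteq> {v. x * v \<in> ?V}"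
      by (rule lspan_least[OF F]) (auto simp: algebra_simps intro: cl)
    then show ?thesis using that by blast
  qed
  have xi: "x ^ i * v \<in> ?V" if "v \<in> ?V" for v i
    using that x1 by (induction i) (auto simp: mult.assoc)
  have mult: "u * v \<in> ?V" if "u \<in> ?V" "v \<in> ?V" for u v
  proof -
    have "set U \<subseteq> {u. u * v \<in> ?V}" using xi[OF that(2)] by (auto simp: U_def)
    then have "?V \<subseteq> {u. u * v \<in> ?V}"
      by (rule lspan_least[OF F]) (auto simp: algebra_simps intro: cl)
    then show ?thesis using that by blast
  qed
  have root: "is_subfield {x. x ^ (?p ^ 1) \<in> F}" by (rule root_subfield[OF char_pos F])
  have "?V \<subseteq> {x. x ^ (?p ^ 1) \<in> F}"
  proof (rule lspan_least[OF F])
    show "set U \<subseteq> {x. x ^ (?p ^ 1) \<in> F}"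
      using is_subfieldD(8)[OF root, of x] x(2) by (auto simp: U_def)
    fix c y assume "c \<in> F" "y \<in> {x. x ^ (?p ^ 1) \<in> F}"
    then show "c * y \<in> {x. x ^ (?p ^ 1) \<in> F}"
      by (auto simp: power_mult_distrib intro: is_subfieldD[OF F])
  qed (use is_subfieldD(1,3)[OF root] in auto)
  then have "is_subfield ?V"
    by (intro subfield_of_purely_inseparable[OF char_pos F FV cl(2) mult]) (auto intro!: exI[of _ 1])
  moreover have "x \<in> ?V" using xi[OF one, of 1] by simp
  ultimately have "gen F {x} \<subseteq> ?V" using FV by (intro gen_least) auto
  moreover have "?V \<subseteq> gen F {x}"
  proof (rule lspan_least[OF F])
    show "set U \<subseteq> gen F {x}"
      using gen_gens[of "{x}" F] by (auto simp: U_def intro: is_subfieldD(8)[OF gen_subfield])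
  qed (use gen_base[of F "{x}"] is_subfieldD(1,3,5)[OF gen_subfield[of F "{x}"]] in auto)
  ultimately have "?V = gen F {x}" by blast
  then show "fin_ext F (gen F {x})" "ext_deg F (gen F {x}) = ?p"
    using fin_extI[OF F ind] by (auto simp: U_def)
qed

text \<open>Induction through \<open>F(x^p)\<close>. This field has exponent \<open>e\<close> over
  \<open>F\<close> but \<open>x\<close> has exact exponent \<open>e + 1\<close>, so \<open>x\<close>
  is not in it and the last step has degree \<open>p\<close>.\<close>

lemma adjoin_root_iterated:
  fixes F :: "'a set"
  assumes F: "is_subfield F" and x: "x ^ (CHAR('a) ^ e) \<in> F" "\<And>i. i < e \<Longrightarrow> x ^ (CHAR('a) ^ i) \<notin> F"
  shows "fin_ext F (gen F {x}) \<and> ext_deg F (gen F {x}) = CHAR('a) ^ e"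
  using x
proof (induction e arbitrary: x)
  case 0
  then show ?case using fin_ext_refl[OF F] gen_absorb[OF F, of "{x}"] by simp
next
  case (Suc e)
  let ?p = "CHAR('a)"
  let ?H = "gen F {x ^ ?p}"
  have pow: "(x ^ ?p) ^ (?p ^ i) = x ^ (?p ^ Suc i)" for i by (simp flip: power_mult)
  have H: "fin_ext F ?H \<and> ext_deg F ?H = ?p ^ e"
    using Suc.prems by (intro Suc.IH) (auto simp: pow simp del: power_Suc)
  have "exponent_le e F ?H"
    using Suc.prems(1) by (intro exponent_le_gen[OF char_pos F]) (auto simp: exponent_le_def frob_def pow simp del: power_Suc)
  then have "x \<notin> ?H" using exponent_leD[OF char_pos, of e F ?H x] Suc.prems(2)[of e] by auto
  moreover have "x ^ ?p \<in> ?H" using gen_gens[of "{x ^ ?p}" F] by simp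
  ultimately have *: "fin_ext ?H (gen ?H {x})" "ext_deg ?H (gen ?H {x}) = ?p"
    using adjoin_root[OF gen_subfield] by blast+
  have "gen ?H {x} = gen F {x}"
    unfolding gen_gen using gen_base[of F] gen_gens[of "{x}" F] gen_gens[of "{x ^ ?p} \<union> {x}" F] is_subfieldD(8)[OF gen_subfield, of x F "{x}"]
    by (intro gen_eqI) auto
  then show ?case using fin_ext_trans[OF F gen_subfield conjunct1[OF H] *(1)] H *(2) by simp
qed

lemma fin_ext_gen:
  fixes F :: "'a set"
  assumes F: "is_subfield F" and S: "finite S" "\<And>x. x \<in> S \<Longrightarrow> \<exists>n. x ^ (CHAR('a) ^ n) \<in> F"
  shows "fin_ext F (gen F S)"
  using S
proof (induction rule: finite_induct)
  case empty
  then show ?case using fin_ext_refl[OF F] gen_absorb[OF F, of "{}"] by simp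
next
  case (insert x S)
  let ?H = "gen F S"
  define e where "e = (LEAST n. x ^ (CHAR('a) ^ n) \<in> ?H)"
  obtain n where "x ^ (CHAR('a) ^ n) \<in> F" using insert.prems by blast
  then have "x ^ (CHAR('a) ^ n) \<in> ?H" using gen_base by blast
  then have "x ^ (CHAR('a) ^ e) \<in> ?H" unfolding e_def by (rule LeastI)
  moreover have "x ^ (CHAR('a) ^ i) \<notin> ?H" if "i < e" for i
    using not_less_Least that unfolding e_def by blast
  ultimately have "fin_ext ?H (gen ?H {x})"
    using adjoin_root_iterated[OF gen_subfield[of F S], of x e] by blast
  moreover have "fin_ext F ?H" using insert by blast
  ultimately have "fin_ext F (gen ?H {x})"
    using fin_ext_trans(1)[OF F gen_subfield] by blast
  then show ?case by (simp add: gen_gen)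
qed

text \<open>Generators are adjoined one by one and kept only when new; each one kept multiplies the
  degree by \<open>p\<close>.\<close>

lemma p_basis:
  fixes C :: "'a set"
  assumes C: "is_subfield C" and G: "finite G" "exponent_le 1 C G"
  shows "fin_ext C (gen C G) \<and> (\<exists>G'\<subseteq>G. gen C G' = gen C G \<and> ext_deg C (gen C G) = CHAR('a) ^ card G')"
  using G
proof (induction rule: finite_induct)
  case empty
  then show ?case using fin_ext_refl[OF C] gen_absorb[OF C, of "{}"] by simp
next
  case (insert x G)
  let ?H = "gen C G"
  have "exponent_le 1 C G" and xp: "x ^ CHAR('a) \<in> C"
    using insert.prems by (auto simp: exponent_le_def frob_def)
  then obtain G' where H: "fin_ext C ?H" and G': "G' \<subseteq> G" "gen C G' = ?H" "ext_deg C ?H = CHAR('a) ^ card G'"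
    using insert.IH by blast
  have eq: "gen C (insert x G) = gen ?H {x}" by (simp add: gen_gen)
  show ?case
  proof (cases "x \<in> ?H")
    case True
    then have "gen C (insert x G) = ?H" unfolding eq by (intro gen_absorb gen_subfield) simp
    then show ?thesis using H G' by auto
  next
    case False
    have "x ^ CHAR('a) \<in> ?H" using xp gen_base by blast
    then have *: "fin_ext ?H (gen ?H {x})" "ext_deg ?H (gen ?H {x}) = CHAR('a)"
      using adjoin_root[OF gen_subfield False] by blast+
    note ** = fin_ext_trans[OF C gen_subfield H *(1)]
    have "finite G'" "x \<notin> G'" using G'(1) insert.hyps finite_subset by blast+
    then have "ext_deg C (gen C (insert x G)) = CHAR('a) ^ card (insert x G')"
      using **(2) *(2) G'(3) by (simp add: eq)
    moreover have "gen C (insert x G') = gen C (insert x G)"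
    proof -
      have "gen C (insert x G') = gen (gen C G') {x}" by (simp add: gen_gen)
      then show ?thesis using G'(2) eq by simp
    qed
    ultimately show ?thesis
      using **(1) G'(1) eq by (intro conjI exI[of _ "insert x G'"]) auto
  qed
qed

lemma ext_deg_le_power:
  fixes C :: "'a set"
  assumes "is_subfield C" "finite G" "exponent_le 1 C G" "card G \<le> r"
  shows "ext_deg C (gen C G) \<le> CHAR('a) ^ r"
proof -
  obtain G' where "G' \<subseteq> G" "ext_deg C (gen C G) = CHAR('a) ^ card G'"
    using p_basis[OF assms(1-3)] by blast
  moreover have "card G' \<le> r" using card_mono[OF assms(2), of G'] calculation(1) assms(4) by simp
  ultimately show ?thesis using char_pos by (simp add: power_increasing)
qed

text \<open>Compare \<open>[E : k(E'\<^sup>p)] = [E : E'] [E' : k(E'\<^sup>p)] = [E : k(E\<^sup>p)] [k(E\<^sup>p) : k(E'\<^sup>p)]\<close>, where the last factor is at most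
  \<open>[E\<^sup>p : E'\<^sup>p] = [E : E']\<close>.\<close>

lemma p_degree_mono:
  fixes k E E' :: "'a set"
  assumes k: "is_subfield k" and E': "is_subfield E'" and E: "is_subfield E"
    and kE': "k \<subseteq> E'" and E'E: "E' \<subseteq> E" and fin: "fin_ext k E" and pi: "exponent_le n k E"
  shows "ext_deg (gen k (frob 1 E')) E' \<le> ext_deg (gen k (frob 1 E)) E"
proof -
  define C' where "C' = gen k (frob 1 E')"
  define C where "C = gen k (frob 1 E)"
  have sub: "is_subfield C'" "is_subfield C" by (simp_all add: C_def C'_def gen_subfield)
  have kE: "k \<subseteq> E" using kE' E'E by blast
  have kC': "k \<subseteq> C'" by (simp add: C'_def gen_base)
  have C'C: "C' \<subseteq> C" unfolding C_def C'_def by (intro gen_mono frob_mono E'E order_refl)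
  have CE: "C \<subseteq> E" unfolding C_def by (intro gen_least E kE frob_subset) auto
  have C'E': "C' \<subseteq> E'" unfolding C'_def by (intro gen_least E' kE' frob_subset) auto
  have fC'E: "fin_ext C' E" using fin_ext_upper[OF k sub(1) E kC' _ fin] C'C CE by blast
  have fE'E: "fin_ext E' E" using fin_ext_upper[OF k E' E kE' E'E fin] .
  have d1: "ext_deg C' E = ext_deg C' E' * ext_deg E' E"
    using ext_deg_mult[OF sub(1) E' E C'E' E'E fC'E] .
  have d2: "ext_deg C' E = ext_deg C' C * ext_deg C E"
    using ext_deg_mult[OF sub(1,2) E C'C CE fC'E] .
  have C_eq: "gen C' (frob 1 E) = C"
    unfolding C'_def C_def gen_gen using frob_mono[OF E'E, of 1] by (simp add: Un_absorb1)
  have "ext_deg C' (gen C' (frob 1 E)) \<le> ext_deg (frob 1 E') (frob 1 E)"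
  proof (rule base_change(2)[OF char_pos])
    show "exponent_le n (frob 1 E') (frob 1 E)"
      using frob_mono[of "frob n E" E' 1] pi kE' by (auto simp: exponent_le_def frob_frob add.commute)
    show "frob 1 E' \<subseteq> C'" unfolding C'_def by (rule gen_gens)
  qed (use sub frob_subfield[OF char_pos] E E' frob_mono[OF E'E] frob_fin_ext[OF char_pos E' fE'E] in auto)
  also have "\<dots> = ext_deg E' E" using frob_fin_ext(2)[OF char_pos E' fE'E] .
  finally have "ext_deg C' E' * ext_deg E' E \<le> ext_deg E' E * ext_deg C E"
    using d1 d2 C_eq by (metis mult_le_mono1)
  then show ?thesis
    using ext_deg_pos[OF E' E E'E fE'E] by (simp add: C_def C'_def mult.commute)
qed

end

subsection \<open>Locally \<open>r\<close>-generated extensions\<close>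

text \<open>Stands in for a bound \<open>r\<close> on \<open>di k K\<close>. It refers to finite
  subsets instead of root parts, which would change with the base field during the
  induction.\<close>

definition locally_gen :: "'a::field set \<Rightarrow> 'a set \<Rightarrow> nat \<Rightarrow> bool" where
  "locally_gen k K r \<longleftrightarrow>
     (\<forall>S. finite S \<and> S \<subseteq> K \<longrightarrow> (\<exists>G\<subseteq>K. finite G \<and> card G \<le> r \<and> S \<subseteq> gen k G))"

lemma locally_genE:
  assumes "locally_gen k K r" "finite S" "S \<subseteq> K"
  obtains G where "G \<subseteq> K" "finite G" "card G \<le> r" "S \<subseteq> gen k G"
proof -
  have "\<exists>G\<subseteq>K. finite G \<and> card G \<le> r \<and> S \<subseteq> gen k G"
    using assms(1)[unfolded locally_gen_def, THEN spec, of S] assms(2,3) by simp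
  then show ?thesis using that by blast
qed

lemma purely_inseparableD:
  fixes k K :: "'a::field set"
  assumes "purely_inseparable k K"
  shows "is_subfield k" "is_subfield K" "k \<subseteq> K" "x \<in> K \<Longrightarrow> \<exists>n. x ^ (CHAR('a) ^ n) \<in> k"
  using assms by (auto simp: purely_inseparable_def)

lemma fin_ext_gens:
  assumes "is_subfield F" "is_subfield E" "F \<subseteq> E" "fin_ext F E"
  obtains S where "finite S" "S \<subseteq> E" "gen F S = E"
proof -
  obtain U where U: "lspan F U = E" using fin_ext_basis[OF assms(1,4)] by blast
  have UE: "set U \<subseteq> E" using lspanI[OF assms(1), of U] U by simp
  have "lspan F U \<subseteq> gen F (set U)"
    by (rule lspan_least[OF assms(1)])
      (use gen_gens[of "set U" F] gen_base[of F "set U"] is_subfieldD(1,3,5)[OF gen_subfield[of F "set U"]] in auto)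
  then have "gen F (set U) = E" using U gen_least[OF assms(2,3) UE] by simp
  then show ?thesis using that[of "set U"] UE by simp
qed

context
  fixes ty :: "'a::field itself"
  assumes char_pos: "CHAR('a) > 0"
begin

text \<open>\<open>E\<close> lies in some \<open>M = k(G)\<close> with at most \<open>r\<close>
  generators. The degree over the field generated by p-th powers only grows from \<open>E\<close> to
  \<open>M\<close>, and \<open>G\<close> bounds it for \<open>M\<close>.\<close>

lemma p_degree_bound:
  fixes k K E :: "'a set"
  assumes K: "purely_inseparable k K" "locally_gen k K r"
    and E: "is_subfield E" "k \<subseteq> E" "E \<subseteq> K" "fin_ext k E"
  shows "ext_deg (gen k (frob 1 E)) E \<le> CHAR('a) ^ r"
proof -
  note k = purely_inseparableD(1)[OF K(1)]
  obtain S where S: "finite S" "S \<subseteq> E" "gen k S = E" using fin_ext_gens[OF k E(1,2,4)] .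
  then obtain G where G: "G \<subseteq> K" "finite G" "card G \<le> r" "S \<subseteq> gen k G"
    using locally_genE[OF K(2), of S] E(3) by (metis subset_trans)
  let ?M = "gen k G"
  have pi: "\<exists>n. x ^ (CHAR('a) ^ n) \<in> k" if "x \<in> G" for x
    using that G(1) purely_inseparableD(4)[OF K(1)] by blast
  obtain n where "exponent_le n k G" using finite_exponent[OF char_pos k G(2) pi] by blast
  then have expM: "exponent_le n k ?M" by (rule exponent_le_gen[OF char_pos k])
  have "E \<subseteq> ?M" using G(4) gen_least[OF gen_subfield gen_base, of S k G] S(3) by simp
  then have le: "ext_deg (gen k (frob 1 E)) E \<le> ext_deg (gen k (frob 1 ?M)) ?M"
    using expM p_degree_mono[OF char_pos k E(1) gen_subfield E(2)] fin_ext_gen[OF char_pos k G(2) pi] by blast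
  have eq: "gen (gen k (frob 1 ?M)) G = ?M"
  proof -
    have "frob 1 ?M \<subseteq> ?M" by (intro frob_subset gen_subfield order_refl)
    then show ?thesis
      unfolding gen_gen using gen_base[of k] gen_gens[of "frob 1 ?M \<union> G" k] gen_gens[of G k]
      by (intro gen_eqI) auto
  qed
  have "ext_deg (gen k (frob 1 ?M)) (gen (gen k (frob 1 ?M)) G) \<le> CHAR('a) ^ r"
  proof (rule ext_deg_le_power[OF char_pos gen_subfield G(2) _ G(3)])
    show "exponent_le 1 (gen k (frob 1 ?M)) G"
      using frob_mono[OF gen_gens[of G k], of 1] gen_gens[of "frob 1 ?M" k] by (auto simp: exponent_le_def)
  qed
  then show ?thesis using le unfolding eq by simp
qed

text \<open>Passing from \<open>E\<close> to \<open>k(E^p)\<close> lowers the exponent by one at the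
  cost of a factor at most \<open>p^r\<close>.\<close>

lemma ext_deg_bound:
  fixes k K E :: "'a set"
  assumes K: "purely_inseparable k K" "locally_gen k K r"
    and E: "is_subfield E" "k \<subseteq> E" "E \<subseteq> K" "fin_ext k E" "exponent_le n k E"
  shows "ext_deg k E \<le> CHAR('a) ^ (r * n)"
  using E
proof (induction n arbitrary: E)
  case 0
  then have "E = k" by (auto simp: exponent_le_def frob_0)
  then show ?case using fin_ext_refl(2)[OF purely_inseparableD(1)[OF K(1)]] by simp
next
  case (Suc n)
  note k = purely_inseparableD(1)[OF K(1)]
  let ?C = "gen k (frob 1 E)"
  have CE: "?C \<subseteq> E" using Suc.prems by (intro gen_least frob_subset) auto
  have "exponent_le n k ?C"
    using Suc.prems(5) by (intro exponent_le_gen[OF char_pos k]) (simp add: exponent_le_def frob_frob)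
  then have "ext_deg k ?C \<le> CHAR('a) ^ (r * n)"
    using CE Suc.prems fin_ext_lower[OF k gen_subfield Suc.prems(1) gen_base CE Suc.prems(4)]
    by (intro Suc.IH gen_subfield gen_base) auto
  moreover have "ext_deg ?C E \<le> CHAR('a) ^ r"
    using p_degree_bound[OF K Suc.prems(1-4)] .
  moreover have "ext_deg k E = ext_deg k ?C * ext_deg ?C E"
    using ext_deg_mult[OF k gen_subfield Suc.prems(1) gen_base CE Suc.prems(4)] .
  ultimately have "ext_deg k E \<le> CHAR('a) ^ (r * n) * CHAR('a) ^ r" by (simp only: mult_le_mono)
  then show ?case by (simp add: power_add mult.commute)
qed

text \<open>A finite \<open>S\<close> with \<open>[C(S) : C]\<close> maximal cannot be enlarged,
  hence generates everything.\<close>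

lemma finitely_generated:
  fixes C K :: "'a set"
  assumes C: "is_subfield C" and K: "is_subfield K" "C \<subseteq> K"
    and bound: "\<And>S. finite S \<Longrightarrow> S \<subseteq> K \<Longrightarrow> fin_ext C (gen C S) \<and> ext_deg C (gen C S) \<le> N"
  obtains S where "finite S" "S \<subseteq> K" "gen C S = K"
proof -
  define P where "P S \<longleftrightarrow> finite S \<and> S \<subseteq> K" for S
  have P_bound: "P S \<Longrightarrow> ext_deg C (gen C S) < Suc N" for S using bound by (simp add: P_def less_Suc_eq_le)
  have "P {}" by (simp add: P_def)
  then obtain S where S: "P S" and max: "\<And>T. P T \<Longrightarrow> ext_deg C (gen C T) \<le> ext_deg C (gen C S)"
    using ex_has_greatest_nat[of P "{}" "\<lambda>S. ext_deg C (gen C S)" "Suc N"] P_bound by blast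
  have "x \<in> gen C S" if "x \<in> K" for x
  proof -
    have "P (insert x S)" using S that by (simp add: P_def)
    then have "fin_ext C (gen C (insert x S))" "ext_deg C (gen C (insert x S)) \<le> ext_deg C (gen C S)"
      using bound max by (simp_all add: P_def)
    then have "gen C S = gen C (insert x S)"
      using gen_mono[OF order_refl, of S "insert x S" C]
      by (intro ext_deg_le_imp_eq[OF C gen_subfield gen_subfield gen_base]) auto
    then show ?thesis using gen_gens[of "insert x S" C] by auto
  qed
  moreover have "gen C S \<subseteq> K" using gen_least[OF K] S by (simp add: P_def)
  ultimately show ?thesis using that[of S] S by (auto simp: P_def)
qed

section \<open>Root parts and their finiteness\<close>

lemma root_part_subfield:
  fixes k K :: "'a set"
  shows "is_subfield k \<Longrightarrow> is_subfield K \<Longrightarrow> is_subfield (root_part n k K)"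
proof -
  assume "is_subfield k" "is_subfield K"
  moreover have "root_part n k K = K \<inter> {x. x ^ (CHAR('a) ^ n) \<in> k}" by (auto simp: root_part_def)
  ultimately show ?thesis using root_subfield[OF char_pos, of k n] by (auto simp: is_subfield_def)
qed

lemma subset_root_part:
  fixes k K :: "'a set"
  shows "is_subfield k \<Longrightarrow> k \<subseteq> K \<Longrightarrow> k \<subseteq> root_part n k K"
  by (auto simp: root_part_def intro: is_subfieldD)

lemma exponent_le_root_part:
  fixes k K :: "'a set"
  shows "exponent_le n k (root_part n k K)"
  by (auto simp: exponent_le_def frob_def root_part_def)

lemma frob_root_part:
  fixes k K :: "'a set"
  shows "is_subfield K \<Longrightarrow> frob j (root_part (c + j) k K) \<subseteq> root_part c k K"
  by (auto simp: frob_def root_part_def power_mult[symmetric] power_add mult.commute intro: is_subfieldD)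

text \<open>All finitely generated subextensions of exponent at most \<open>n\<close> have degree at
  most \<open>p^(r n)\<close>, so the root part is itself finitely generated.\<close>

lemma fin_ext_root_part:
  fixes k K :: "'a set"
  assumes K: "purely_inseparable k K" "locally_gen k K r"
  shows "fin_ext k (root_part n k K)"
proof -
  note kK = purely_inseparableD[OF K(1)]
  let ?R = "root_part n k K"
  have R: "is_subfield ?R" "k \<subseteq> ?R" "?R \<subseteq> K"
    using root_part_subfield[OF kK(1,2)] subset_root_part[OF kK(1,3)] by (auto simp: root_part_def)
  have pi: "\<exists>m. x ^ (CHAR('a) ^ m) \<in> k" if "x \<in> ?R" for x using that by (auto simp: root_part_def)
  have fin: "fin_ext k (gen k S)" if "finite S" "S \<subseteq> ?R" for S
    using fin_ext_gen[OF char_pos kK(1) that(1)] pi that(2) by blast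
  have bound: "ext_deg k (gen k S) \<le> CHAR('a) ^ (r * n)" if "finite S" "S \<subseteq> ?R" for S
  proof (rule ext_deg_bound[OF K gen_subfield gen_base _ fin[OF that]])
    show "gen k S \<subseteq> K" using R that kK by (intro gen_least) auto
    show "exponent_le n k (gen k S)"
      using that(2) exponent_le_root_part[of n k K] frob_mono[OF that(2), of n]
      by (intro exponent_le_gen[OF char_pos kK(1)]) (auto simp: exponent_le_def)
  qed
  obtain S where "finite S" "S \<subseteq> ?R" "gen k S = ?R"
    using finitely_generated[OF kK(1) R(1,2), of "CHAR('a) ^ (r * n)"] fin bound by metis
  then show ?thesis using fin by metis
qed

subsection \<open>Modularity\<close>

lemma lin_indep_finite:
  fixes C S :: "'a set"
  shows "lin_indep C S \<longleftrightarrow> (\<forall>T. finite T \<and> T \<subseteq> S \<longrightarrow> lin_indep C T)"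
proof
  assume "lin_indep C S"
  then show "\<forall>T. finite T \<and> T \<subseteq> S \<longrightarrow> lin_indep C T" using lin_indep_mono by blast
next
  assume *: "\<forall>T. finite T \<and> T \<subseteq> S \<longrightarrow> lin_indep C T"
  show "lin_indep C S"
    unfolding lin_indep_def
  proof (intro allI impI)
    fix T c assume T: "finite T \<and> T \<subseteq> S \<and> (\<forall>s\<in>T. c s \<in> C) \<and> (\<Sum>s\<in>T. c s * s) = 0"
    then have "lin_indep C T" using * by blast
    then show "\<forall>s\<in>T. c s = 0" using T unfolding lin_indep_def by blast
  qed
qed

lemma modularI:
  fixes k K :: "'a set"
  assumes "\<And>n T. finite T \<Longrightarrow> T \<subseteq> frob n K \<Longrightarrow> lin_indep (k \<inter> frob n K) T \<Longrightarrow> lin_indep k T"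
  shows "modular k K"
  unfolding modular_def lin_disjoint_def frob_def[symmetric]
proof (intro allI impI)
  fix n S assume S: "S \<subseteq> frob n K \<and> lin_indep (k \<inter> frob n K) S"
  show "lin_indep k S"
    unfolding lin_indep_finite[of k S]
  proof (intro allI impI)
    fix T assume T: "finite T \<and> T \<subseteq> S"
    then show "lin_indep k T" using assms[of T n] S lin_indep_mono[of _ S T] by blast
  qed
qed

text \<open>Here \<open>T\<close> is independent over a field that contains it. So \<open>T\<close>
  has at most one element, which is nonzero, and stays independent over \<open>K\<close>.\<close>

lemma modular_refl:
  fixes K :: "'a set"
  assumes K: "is_subfield K"
  shows "modular K K"
proof (rule modularI)
  fix n T assume T: "finite T" "T \<subseteq> frob n K" "lin_indep (K \<inter> frob n K) T"
  have sub: "frob n K \<subseteq> K" using frob_subset[OF K order_refl] .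
  have fK: "is_subfield (frob n K)" using frob_subfield[OF char_pos K] .
  have ind: "\<forall>s\<in>T. c s = 0" if "\<forall>s\<in>T. c s \<in> frob n K" "(\<Sum>s\<in>T. c s * s) = 0" for c
    using T(1,3) that sub unfolding lin_indep_def by blast
  have "0 \<notin> T"
  proof
    assume "0 \<in> T"
    let ?c = "\<lambda>s::'a. if s = 0 then 1 else 0 :: 'a"
    have "(\<Sum>s\<in>T. ?c s * s) = 0" by (rule sum.neutral) simp
    then have "\<forall>s\<in>T. ?c s = 0" using is_subfieldD(1,2)[OF fK] by (intro ind) auto
    then show False using \<open>0 \<in> T\<close> by (metis one_neq_zero)
  qed
  have "card T \<le> 1"
  proof (rule ccontr)
    assume "\<not> card T \<le> 1"
    then obtain a b where ab: "a \<in> T" "b \<in> T" "a \<noteq> b"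
      by (metis card_le_Suc0_iff_eq T(1) One_nat_def)
    let ?c = "\<lambda>s. if s = a then b else if s = b then - a else 0"
    have "(\<Sum>s\<in>T. ?c s * s) = (\<Sum>s\<in>{a, b}. ?c s * s)"
      by (rule sum.mono_neutral_right) (use T(1) ab in auto)
    also have "\<dots> = 0" using ab(3) by (simp add: algebra_simps)
    finally have "\<forall>s\<in>T. ?c s = 0"
      using ab T(2) is_subfieldD(1,7)[OF fK] by (intro ind) auto
    then show False using ab \<open>0 \<notin> T\<close> by (metis)
  qed
  then consider "T = {}" | t where "T = {t}"
    using T(1) by (metis One_nat_def card_0_eq card_1_singletonE le_SucE le_zero_eq)
  then show "lin_indep K T"
    by cases (use \<open>0 \<notin> T\<close> in \<open>auto simp: lin_indep_def subset_singleton_iff\<close>)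
qed

text \<open>A finite part of \<open>K\<close> lies in some \<open>L(g)\<close>, so its
  \<open>p^n\<close>-th powers lie in \<open>C(b)\<close> with \<open>b = g^(p^n)\<close> and
  \<open>C\<close> the intersection of \<open>L\<close> and \<open>frob n K\<close>. All powers of
  \<open>b\<close> are in \<open>frob n K\<close>, so \<open>b\<close> has the same exact exponent,
  hence the same degree, over \<open>C\<close> as over \<open>L\<close>.\<close>

lemma locally_simple_imp_modular:
  fixes L K :: "'a set"
  assumes K: "purely_inseparable L K" "locally_gen L K 1"
  shows "modular L K"
proof (rule modularI)
  fix n T assume T: "finite T" "T \<subseteq> frob n K" "lin_indep (L \<inter> frob n K) T"
  let ?C = "L \<inter> frob n K"
  note LK = purely_inseparableD[OF K(1)]
  have fK: "is_subfield (frob n K)" using frob_subfield[OF char_pos LK(2)] .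
  have C: "is_subfield ?C" using LK(1) fK by (auto simp: is_subfield_def)
  obtain T0 where T0: "T0 \<subseteq> K" "finite T0" "T = frob n T0"
    using T(1,2) unfolding frob_def by (meson finite_subset_image)
  obtain G where G: "G \<subseteq> K" "finite G" "card G \<le> 1" "T0 \<subseteq> gen L G"
    using locally_genE[OF K(2) T0(2,1)] .
  \<comment> \<open>If \<open>G\<close> is empty, \<open>g = 0\<close> serves.\<close>
  obtain g where g: "G \<subseteq> {g}" "g \<in> K"
  proof (cases "G = {}")
    case True
    then show ?thesis using that[of 0] is_subfieldD(1)[OF LK(2)] by auto
  next
    case False
    then have "card G = 1" using G(2,3) by (metis card_0_eq le_antisym less_one linorder_not_le)
    then show ?thesis using that G(1) by (metis card_1_singletonE insert_subset order_refl)
  qed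
  define b where "b = g ^ (CHAR('a) ^ n)"
  have bK: "b \<in> frob n K" unfolding b_def using g(2) by (rule frobI)
  define e where "e = (LEAST e. b ^ (CHAR('a) ^ e) \<in> L)"
  have "\<exists>e. b ^ (CHAR('a) ^ e) \<in> L"
    using LK(4)[of b] frob_subset[OF LK(2) order_refl] bK by blast
  then have be: "b ^ (CHAR('a) ^ e) \<in> L" unfolding e_def by (rule LeastI_ex)
  have min: "b ^ (CHAR('a) ^ i) \<notin> L" if "i < e" for i
    using not_less_Least that unfolding e_def by blast
  have beC: "b ^ (CHAR('a) ^ e) \<in> ?C" using be bK is_subfieldD(8)[OF fK] by blast
  have L_deg: "ext_deg L (gen L {b}) = CHAR('a) ^ e"
    using adjoin_root_iterated[OF char_pos LK(1) be min] by blast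
  have C_deg: "fin_ext ?C (gen ?C {b})" "ext_deg ?C (gen ?C {b}) = CHAR('a) ^ e"
    using adjoin_root_iterated[OF char_pos C beC] min by blast+
  have eq: "gen L (gen ?C {b}) = gen L {b}"
    using gen_base[of L] gen_gens[of "{b}" L] gen_gens[of "gen ?C {b}" L] gen_gens[of "{b}" ?C]
      gen_mono[of ?C L "{b}" "{b}"]
    by (intro gen_eqI) auto
  have "frob n L \<subseteq> ?C" using frob_subset[OF LK(1) order_refl] frob_mono[OF LK(3)] by blast
  have "T \<subseteq> frob n (gen L {g})"
    unfolding T0(3) using G(4) gen_mono[OF order_refl g(1), of L] by (intro frob_mono) blast
  also have "\<dots> = gen (frob n L) {b}"
    by (simp add: frob_gen[OF char_pos]) (simp add: frob_def b_def)
  also have "\<dots> \<subseteq> gen ?C {b}" using \<open>frob n L \<subseteq> ?C\<close> by (rule gen_mono) simp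
  finally have TC: "T \<subseteq> gen ?C {b}" .
  show "lin_indep L T"
  proof (rule base_change_indep[OF char_pos C LK(1) gen_subfield _ gen_base _ C_deg(1) _ T(1) TC T(3)])
    show "exponent_le e ?C (gen ?C {b})"
      using beC by (intro exponent_le_gen[OF char_pos C]) (simp add: exponent_le_def frob_def)
  qed (use eq L_deg C_deg in auto)
qed

end

subsection \<open>A modular tower inside a \<open>q\<close>-finite extension\<close>

lemma bounded_mono_eventually_constant:
  fixes q :: "nat \<Rightarrow> nat"
  assumes "\<And>c. q c \<le> q (Suc c)" "\<And>c. q c \<le> N"
  shows "\<exists>c0. \<forall>c\<ge>c0. q c = q c0"
proof -
  have "\<forall>c. True \<longrightarrow> q c < Suc N" using assms(2) by (simp add: less_Suc_eq_le)
  then obtain c0 where max: "\<And>c. q c \<le> q c0"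
    using ex_has_greatest_nat[of "\<lambda>_. True" 0 q "Suc N"] by blast
  have "q c0 \<le> q c" if "c \<ge> c0" for c using lift_Suc_mono_le[of q] assms(1) that by blast
  with max show ?thesis by (intro exI[of _ c0]) (simp add: le_antisym)
qed

text \<open>Applied to \<open>R/k\<close>, \<open>core\<close> gives the tower \<open>E\<^sub>c\<close>; the intersection is attained at a finite stage.\<close>

definition core_step :: "'a::field set \<Rightarrow> 'a set \<Rightarrow> nat \<Rightarrow> nat \<Rightarrow> 'a set" where
  "core_step k K j c = gen k (frob j (root_part (c + j) k K))"

definition core :: "'a::field set \<Rightarrow> 'a set \<Rightarrow> nat \<Rightarrow> 'a set" where
  "core k K c = (\<Inter>j. core_step k K j c)"

context
  fixes k K :: "'a::field set" and r :: nat
  assumes char_pos: "CHAR('a) > 0" and pi: "purely_inseparable k K" and lg: "locally_gen k K r"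
begin

lemma subfields: "is_subfield k" "is_subfield K" "k \<subseteq> K"
  using purely_inseparableD[OF pi] by blast+

lemma root_part_facts:
  "is_subfield (root_part n k K)" "k \<subseteq> root_part n k K" "root_part n k K \<subseteq> K"
  using root_part_subfield[OF char_pos subfields(1,2)] subset_root_part[OF char_pos subfields(1,3)]
  by (auto simp: root_part_def)

lemma fin_ext_subset_root_part:
  assumes "is_subfield E" "k \<subseteq> E" "E \<subseteq> root_part c k K"
  shows "fin_ext k E"
  using fin_ext_lower[OF subfields(1) assms(1) root_part_facts(1) assms(2,3)] fin_ext_root_part[OF char_pos pi lg] by blast

lemma core_step_subset: "core_step k K j c \<subseteq> root_part c k K"
  unfolding core_step_def
  by (intro gen_least root_part_facts frob_root_part[OF char_pos] subfields)

lemma core_step_antimono: "core_step k K (Suc j) c \<subseteq> core_step k K j c"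
proof -
  have "frob 1 (root_part (c + j + 1) k K) \<subseteq> root_part (c + j) k K"
    by (rule frob_root_part[OF char_pos subfields(2)])
  then have "frob j (frob 1 (root_part (c + j + 1) k K)) \<subseteq> frob j (root_part (c + j) k K)"
    by (rule frob_mono)
  then show ?thesis unfolding core_step_def by (intro gen_mono) (simp_all add: frob_frob)
qed

text \<open>The stages decrease inside the root part, which is finite over \<open>k\<close>; from a
  stage of least degree on they are all equal.\<close>

lemma core_step_eventually: "\<exists>N. \<forall>j\<ge>N. core_step k K j c = core k K c"
proof -
  let ?d = "\<lambda>j. ext_deg k (core_step k K j c)"
  obtain N where N: "\<And>j. ?d N \<le> ?d j" using ex_has_least_nat[of "\<lambda>_. True" 0 ?d] by blast
  have anti: "core_step k K j c \<subseteq> core_step k K i c" if "i \<le> j" for i j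
    using lift_Suc_antimono_le[of "\<lambda>j. core_step k K j c"] core_step_antimono that by blast
  have eq: "core_step k K j c = core_step k K N c" if "N \<le> j" for j
  proof (rule ext_deg_le_imp_eq[OF subfields(1) _ _ _ anti[OF that] _ N])
    show "fin_ext k (core_step k K N c)"
      using fin_ext_subset_root_part[OF _ _ core_step_subset] by (simp add: core_step_def gen_subfield gen_base)
  qed (simp_all add: core_step_def gen_subfield gen_base)
  have core: "core_step k K N c = core k K c"
  proof (rule subset_antisym)
    show "core_step k K N c \<subseteq> core k K c"
      unfolding core_def
    proof (rule INT_greatest)
      fix j
      show "core_step k K N c \<subseteq> core_step k K j c"
        using anti[of j "max j N"] eq[of "max j N"] by simp
    qed
  qed (auto simp: core_def)
  show ?thesis by (intro exI[of _ N] allI impI trans[OF eq core])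
qed

lemma core_subfield: "is_subfield (core k K c)"
  and core_base: "k \<subseteq> core k K c"
  and core_subset: "core k K c \<subseteq> root_part c k K"
proof -
  obtain j where j: "core_step k K j c = core k K c" using core_step_eventually by blast
  show "is_subfield (core k K c)" "k \<subseteq> core k K c" "core k K c \<subseteq> root_part c k K"
    using core_step_subset[of j c] unfolding j[symmetric] by (simp_all add: core_step_def gen_subfield gen_base)
qed

lemma core_subset_K: "core k K c \<subseteq> K"
  using core_subset[of c] root_part_facts(3) by blast

lemma fin_ext_core: "fin_ext k (core k K c)"
  using fin_ext_subset_root_part core_subfield core_base core_subset by blast

lemma exponent_le_core: "exponent_le c k (core k K c)"
  using exponent_le_root_part[OF char_pos, of c k K] frob_mono[OF core_subset, of c c]
  by (auto simp: exponent_le_def)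

text \<open>At a stage \<open>j\<close> late enough for both indices, one more Frobenius turns stage
  \<open>j\<close> at \<open>c + 1\<close> into stage \<open>j + 1\<close> at
  \<open>c\<close>.\<close>

lemma frob_core: "gen k (frob 1 (core k K (Suc c))) = core k K c"
proof -
  obtain N M where N: "\<forall>j\<ge>N. core_step k K j (Suc c) = core k K (Suc c)"
    and M: "\<forall>j\<ge>M. core_step k K j c = core k K c" using core_step_eventually by metis
  let ?j = "max N M"
  have "core k K (Suc c) = core_step k K ?j (Suc c)" "core k K c = core_step k K (Suc ?j) c"
    using N M by (simp_all add: le_SucI)
  then show ?thesis
    by (simp add: core_step_def gen_frob_gen[OF char_pos subfields(1)] frob_frob)
qed

lemma frob_core_iterate: "gen k (frob i (core k K (c + i))) = core k K c"
proof (induction i)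
  case 0
  then show ?case
    using gen_least[OF core_subfield core_base order_refl] gen_gens[of "core k K c" k] by (auto simp: frob_0)
next
  case (Suc i)
  have "core k K (c + i) = gen k (frob 1 (core k K (c + Suc i)))" using frob_core[of "c + i"] by simp
  then have "core k K c = gen k (frob i (gen k (frob 1 (core k K (c + Suc i)))))" using Suc by simp
  then show ?case by (simp add: gen_frob_gen[OF char_pos subfields(1)] frob_frob)
qed

lemma core_mono: "c \<le> d \<Longrightarrow> core k K c \<subseteq> core k K d"
proof (rule lift_Suc_mono_le)
  fix c
  show "core k K c \<subseteq> core k K (Suc c)"
    unfolding frob_core[symmetric, of c]
    by (intro gen_least frob_subset core_subfield core_base order_refl)
qed

text \<open>If \<open>core k K (n + 1)\<close> had exponent \<open>n\<close>, then
  \<open>core k K 1\<close>, generated by its \<open>p^n\<close>-th powers, would be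
  \<open>k\<close>. But \<open>core k K 1\<close> is a stage \<open>k(R^(p^j))\<close> with
  \<open>R\<close> the root part of exponent \<open>1 + j\<close>, and unbounded exponent supplies
  an element of \<open>R\<close> of exactly that exponent.\<close>

lemma core_exact_exponent:
  assumes unb: "unbounded_exponent k K"
  shows "\<exists>a\<in>core k K (Suc n). a ^ (CHAR('a) ^ n) \<notin> k"
proof (rule ccontr)
  assume "\<not> ?thesis"
  then have "frob n (core k K (1 + n)) \<subseteq> k" by (auto simp: frob_def)
  then have core1: "core k K 1 = k" using frob_core_iterate[of n 1] gen_absorb[OF subfields(1)] by metis
  obtain j where j: "core_step k K j 1 = core k K 1" using core_step_eventually by blast
  obtain x where x: "x \<in> K" "x ^ (CHAR('a) ^ j) \<notin> k" using unb by (auto simp: unbounded_exponent_def)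
  define e where "e = (LEAST e. x ^ (CHAR('a) ^ e) \<in> k)"
  have e: "x ^ (CHAR('a) ^ e) \<in> k"
    unfolding e_def using purely_inseparableD(4)[OF pi x(1)] by (rule LeastI_ex)
  have "e > j"
  proof (rule ccontr)
    assume "\<not> e > j"
    then have "x ^ (CHAR('a) ^ j) = (x ^ (CHAR('a) ^ e)) ^ (CHAR('a) ^ (j - e))"
      by (simp flip: power_mult power_add)
    then show False using x(2) is_subfieldD(8)[OF subfields(1) e] by simp
  qed
  then obtain d where d: "e = Suc (d + j)" using less_imp_Suc_add by (metis add.commute)
  \<comment> \<open>\<open>x\<close> has exact exponent \<open>e = 1 + d + j\<close>, so this power
    of it has exact exponent \<open>1 + j\<close>.\<close>
  define y where "y = x ^ (CHAR('a) ^ d)"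
  have y_pow: "y ^ (CHAR('a) ^ i) = x ^ (CHAR('a) ^ (d + i))" for i
    by (simp add: y_def power_add flip: power_mult)
  have "y \<in> root_part (1 + j) k K"
    using e is_subfieldD(8)[OF subfields(2) x(1)] y_pow[of "1 + j"]
    by (simp add: root_part_def y_def d del: power_Suc)
  then have "y ^ (CHAR('a) ^ j) \<in> core_step k K j 1"
    unfolding core_step_def using gen_gens frobI by blast
  then have "x ^ (CHAR('a) ^ (d + j)) \<in> k" using j core1 by (simp add: y_pow)
  then have "e \<le> d + j" unfolding e_def by (rule Least_le)
  then show False by (simp add: d)
qed

text \<open>By \<open>frob_core\<close> each step is an extension of the form \<open>E\<close> over
  \<open>k(E^p)\<close>, so \<open>p_degree_mono\<close> and \<open>p_degree_bound\<close> apply to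
  its degree.\<close>

lemma core_degrees: "\<exists>q c0. \<forall>c\<ge>c0. ext_deg (core k K c) (core k K (Suc c)) = q"
proof -
  let ?q = "\<lambda>c. ext_deg (core k K c) (core k K (Suc c))"
  have "?q c \<le> ?q (Suc c)" for c
    using p_degree_mono[OF char_pos subfields(1) core_subfield core_subfield core_base core_mono
        fin_ext_core exponent_le_core, of "Suc c" "Suc (Suc c)"]
    by (simp only: frob_core)
  moreover have "?q c \<le> CHAR('a) ^ r" for c
    using p_degree_bound[OF char_pos pi lg core_subfield core_base core_subset_K fin_ext_core, of "Suc c"]
    by (simp only: frob_core)
  ultimately show ?thesis using bounded_mono_eventually_constant[of ?q] by blast
qed

lemma fin_ext_core_core: "c \<le> d \<Longrightarrow> fin_ext (core k K c) (core k K d)"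
  using fin_ext_upper[OF subfields(1) core_subfield core_subfield core_base core_mono fin_ext_core] by blast

lemma core_subfield_Union: "is_subfield (\<Union>c. core k K c)"
proof -
  have two: "\<exists>c. x \<in> core k K c \<and> y \<in> core k K c"
    if xy: "x \<in> (\<Union>c. core k K c)" "y \<in> (\<Union>c. core k K c)" for x y
  proof -
    obtain c d where "x \<in> core k K c" "y \<in> core k K d" using xy by blast
    then show ?thesis using core_mono[of c "max c d"] core_mono[of d "max c d"]
      by (intro exI[of _ "max c d"]) auto
  qed
  show ?thesis
    unfolding is_subfield_def
  proof (intro conjI ballI)
    show "0 \<in> (\<Union>c. core k K c)" "1 \<in> (\<Union>c. core k K c)"
      using is_subfieldD(1,2)[OF core_subfield] by blast+
    fix x assume x: "x \<in> (\<Union>c. core k K c)"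
    then show "inverse x \<in> (\<Union>c. core k K c)" using is_subfieldD(6)[OF core_subfield] by blast
    fix y assume "y \<in> (\<Union>c. core k K c)"
    then obtain c where xy: "x \<in> core k K c" "y \<in> core k K c" using two x by blast
    show "x + y \<in> (\<Union>c. core k K c)" "x - y \<in> (\<Union>c. core k K c)" "x * y \<in> (\<Union>c. core k K c)"
      using is_subfieldD(3-5)[OF core_subfield xy] by (auto intro!: UN_I[of c])
  qed
qed

lemma finite_subset_core:
  assumes "finite T" "T \<subseteq> (\<Union>c. core k K c)"
  shows "\<exists>c. T \<subseteq> core k K c"
  using assms
proof (induction rule: finite_induct)
  case (insert x T)
  then obtain c d where "T \<subseteq> core k K c" "x \<in> core k K d" by auto
  then show ?case using core_mono[of c "max c d"] core_mono[of d "max c d"]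
    by (intro exI[of _ "max c d"]) auto
qed simp

text \<open>Beyond \<open>c\<^sub>0\<close> the steps of the tower have the same degree \<open>q\<close>. Since \<open>E\<^sub>c\<^sub>-\<^sub>n = k(E\<^sub>c\<^bsup>p\<^sup>n\<^esup>)\<close>,
  the base change of \<open>E\<^sub>c\<^bsup>p\<^sup>n\<^esup>\<close> to \<open>L = E\<^sub>c\<^sub>0\<close> preserves the degree, which is linear disjointness.\<close>

lemma lq_modular_core: "lq_modular k (\<Union>c. core k K c)"
proof -
  let ?E = "core k K"
  let ?m = "\<Union>c. ?E c"
  obtain q c0 where q: "\<And>c. c \<ge> c0 \<Longrightarrow> ext_deg (?E c) (?E (Suc c)) = q" using core_degrees by blast
  have deg: "ext_deg (?E c) (?E (c + i)) = q ^ i" if "c \<ge> c0" for c i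
  proof (induction i)
    case 0
    then show ?case using fin_ext_refl(2)[OF core_subfield] by simp
  next
    case (Suc i)
    have "ext_deg (?E c) (?E (c + Suc i)) = ext_deg (?E c) (?E (c + i)) * ext_deg (?E (c + i)) (?E (Suc (c + i)))"
      using fin_ext_trans(2)[OF core_subfield core_subfield fin_ext_core_core fin_ext_core_core] by simp
    then show ?case using Suc q[of "c + i"] that by simp
  qed
  let ?L = "?E c0"
  have "modular ?L ?m"
  proof (rule modularI[OF char_pos])
    fix n T assume T: "finite T" "T \<subseteq> frob n ?m" "lin_indep (?L \<inter> frob n ?m) T"
    let ?C = "?L \<inter> frob n ?m"
    have C: "is_subfield ?C"
      using core_subfield[of c0] frob_subfield[OF char_pos core_subfield_Union, of n] by (auto simp: is_subfield_def)
    obtain T0 where T0: "T0 \<subseteq> ?m" "finite T0" "T = frob n T0"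
      using T(1,2) unfolding frob_def by (meson finite_subset_image)
    obtain c where c: "T0 \<subseteq> ?E c" using finite_subset_core[OF T0(2,1)] by blast
    \<comment> \<open>The indices are shifted by \<open>n\<close> because \<open>n\<close> Frobenius
      steps descend the tower by \<open>n\<close>: thus \<open>F\<close> lies in \<open>?L\<close>,
      and \<open>E\<close> generates \<open>?E (c0 + c)\<close> over \<open>k\<close>.\<close>
    define F where "F = frob n (?E (c0 + n))"
    define E where "E = frob n (?E (c0 + n + c))"
    have TE: "T \<subseteq> E"
      unfolding T0(3) E_def using c core_mono[of c "c0 + n + c"] by (intro frob_mono) auto
    have F: "is_subfield F" and E: "is_subfield E"
      by (simp_all add: F_def E_def frob_subfield[OF char_pos core_subfield])
    have FE: "F \<subseteq> E" unfolding F_def E_def by (intro frob_mono core_mono) simp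
    have FC: "F \<subseteq> ?C"
    proof
      fix x assume "x \<in> F"
      then show "x \<in> ?C"
        using frob_core_iterate[of n c0] gen_gens[of F k] frob_mono[of "?E (c0 + n)" ?m n]
        by (auto simp: F_def)
    qed
    have fin: "fin_ext F E" and FE_deg: "ext_deg F E = q ^ c"
      using frob_fin_ext[OF char_pos core_subfield fin_ext_core_core, of "c0 + n" "c0 + n + c" n] deg[of "c0 + n" c]
      by (simp_all add: F_def E_def)
    have Ek: "frob (c0 + n + c) E \<subseteq> frob n k"
      using frob_mono[OF exponent_le_core[of "c0 + n + c", unfolded exponent_le_def], of n]
      by (simp add: E_def frob_frob add.commute)
    have expE: "exponent_le (c0 + n + c) F E"
      unfolding exponent_le_def F_def using Ek frob_mono[OF core_base, of n "c0 + n"] by blast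
    \<comment> \<open>The degree can only drop from \<open>E\<close> over \<open>F\<close> to
      \<open>?E'\<close> over \<open>?C\<close> and on to \<open>?E (c0 + c)\<close> over
      \<open>?L\<close>. Both ends are \<open>q ^ c\<close>, so it does not drop.\<close>
    let ?E' = "gen ?C E"
    have E'_fin: "fin_ext ?C ?E'" and "ext_deg ?C ?E' \<le> ext_deg F E"
      using base_change[OF char_pos F C E FC FE expE fin] by blast+
    moreover have "gen ?L ?E' = ?E (c0 + c)"
    proof -
      have "?E (c0 + c) = gen k E"
        using frob_core_iterate[of n "c0 + c"] by (simp add: E_def add_ac)
      then have EE: "E \<subseteq> ?E (c0 + c)" "gen k E = ?E (c0 + c)" using gen_gens by blast+
      have "gen ?L ?E' \<subseteq> ?E (c0 + c)"
        using core_mono[of c0 "c0 + c"] EE(1) by (intro gen_least core_subfield) auto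
      moreover have "gen k E \<subseteq> gen ?L ?E'" by (rule gen_mono[OF core_base gen_gens])
      ultimately show ?thesis using EE(2) by blast
    qed
    ultimately have le: "ext_deg ?C ?E' \<le> ext_deg ?L (gen ?L ?E')"
      using FE_deg deg[of c0 c] by simp
    show "lin_indep ?L T"
    proof (rule base_change_indep[OF char_pos C core_subfield gen_subfield _ gen_base _ E'_fin le T(1) _ T(3)])
      show "exponent_le (c0 + n + c) ?C ?E'"
        using expE FC by (intro exponent_le_gen[OF char_pos C]) (auto simp: exponent_le_def)
      show "T \<subseteq> ?E'" using TE gen_gens by blast
    qed simp
  qed
  then show ?thesis
    unfolding lq_modular_def using core_subfield[of c0] core_base[of c0]
      fin_ext_imp_finite_ext[OF subfields(1) core_subfield fin_ext_core]
    by (intro exI[of _ ?L]) auto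
qed

text \<open>The element of the tower of exact exponent \<open>n\<close> is part of a \<open>p\<close>-basis of the \<open>n\<close>-th root part.\<close>

lemma locally_gen_over_core:
  assumes unb: "unbounded_exponent k K"
  shows "locally_gen (\<Union>c. core k K c) K (r - 1)"
  unfolding locally_gen_def
proof (intro allI impI)
  let ?m = "\<Union>c. core k K c"
  fix S assume S: "finite S \<and> S \<subseteq> K"
  obtain N where "exponent_le N k S"
    using finite_exponent[OF char_pos subfields(1), of S] S purely_inseparableD(4)[OF pi] by blast
  \<comment> \<open>Raised by one so that \<open>C\<close> below has exponent \<open>N\<close> and
    cannot contain an element of exact exponent \<open>Suc N\<close>.\<close>
  then have "exponent_le (Suc N) k S" by (rule exponent_le_mono[OF char_pos _ subfields(1)]) simp
  then have SR: "S \<subseteq> root_part (Suc N) k K"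
    using S exponent_leD[OF char_pos] by (auto simp: root_part_def simp del: power_Suc)
  define R where "R = root_part (Suc N) k K"
  note R = root_part_facts[of "Suc N", folded R_def]
  obtain a where a: "a \<in> core k K (Suc N)" "a ^ (CHAR('a) ^ N) \<notin> k"
    using core_exact_exponent[OF unb] by blast
  have aR: "a \<in> R" using a(1) core_subset unfolding R_def by blast
  have expR: "exponent_le (Suc N) k R" unfolding R_def by (rule exponent_le_root_part[OF char_pos])
  define C where "C = gen k (frob 1 R)"
  have C: "is_subfield C" by (simp add: C_def gen_subfield)
  have CR: "C \<subseteq> R" unfolding C_def by (intro gen_least R frob_subset) simp
  have expC: "exponent_le N k C"
    unfolding C_def using expR by (intro exponent_le_gen[OF char_pos subfields(1)]) (simp add: exponent_le_def frob_frob)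
  have aC: "a \<notin> C" using exponent_leD[OF char_pos expC] a(2) by blast
  have pC: "x ^ CHAR('a) \<in> C" if "x \<in> R" for x
    using frobI[OF that, of 1] gen_gens[of "frob 1 R" k] by (auto simp: C_def)
  have fin: "fin_ext k R" unfolding R_def by (rule fin_ext_root_part[OF char_pos pi lg])
  obtain B where B: "finite B" "B \<subseteq> R" "gen k B = R" using fin_ext_gens[OF subfields(1) R(1,2) fin] .
  \<comment> \<open>Adjoining \<open>a\<close> before the other generators spends on it one factor
    \<open>p\<close> of \<open>[R : C] \<le> p^r\<close>; at most \<open>r - 1\<close> generators
    remain.\<close>
  let ?D = "gen C {a}"
  have DR: "?D \<subseteq> R" using CR aR by (intro gen_least R) auto
  have DB: "gen ?D B = R"
  proof (rule subset_antisym)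
    show "gen ?D B \<subseteq> R" by (rule gen_least[OF R(1) DR B(2)])
    have "k \<subseteq> ?D" using gen_base[of k "frob 1 R"] gen_base[of C "{a}"] by (auto simp: C_def)
    then show "R \<subseteq> gen ?D B" unfolding B(3)[symmetric] by (rule gen_mono[OF _ order_refl])
  qed
  have "exponent_le 1 ?D B"
    using B(2) pC gen_base[of C "{a}"] by (auto simp: exponent_le_def frob_def)
  then obtain G where G: "G \<subseteq> B" "gen ?D G = R" "ext_deg ?D R = CHAR('a) ^ card G" and finD: "fin_ext ?D R"
    using p_basis[OF char_pos gen_subfield B(1), of C "{a}"] unfolding DB by blast
  have "CHAR('a) ^ Suc (card G) = ext_deg C R"
    using fin_ext_trans(2)[OF C gen_subfield adjoin_root(1)[OF char_pos C aC pC[OF aR]] finD]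
      adjoin_root(2)[OF char_pos C aC pC[OF aR]] G(3) by simp
  also have "\<dots> \<le> CHAR('a) ^ r"
    using p_degree_bound[OF char_pos pi lg R fin] by (simp add: C_def)
  finally have "Suc (card G) \<le> r"
    using char_prime[OF char_pos] prime_gt_1_nat power_increasing_iff by blast
  moreover have "R \<subseteq> gen ?m G"
  proof -
    \<comment> \<open>Since \<open>C\<close> is \<open>k(R^p)\<close> and \<open>R\<close> has
      bounded exponent, \<open>a\<close> and \<open>G\<close> generate \<open>R\<close> over
      \<open>k\<close> itself, and \<open>a\<close> already lies in \<open>?m\<close>.\<close>
    have "gen C (insert a G) = R" using G(2) by (simp add: gen_gen)
    then have "gen k (insert a G) = R"
      using gen_of_bounded_exponent[OF char_pos subfields(1) expR] by (simp add: C_def)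
    moreover have "gen k (insert a G) \<subseteq> gen ?m G"
      using a(1) core_base gen_base[of ?m G] gen_gens[of G ?m] by (intro gen_least gen_subfield) blast+
    ultimately show ?thesis by simp
  qed
  ultimately show "\<exists>G\<subseteq>K. finite G \<and> card G \<le> r - 1 \<and> S \<subseteq> gen ?m G"
    using G(1) B(1,2) R(3) SR finite_subset[OF G(1) B(1)] by (intro exI[of _ G]) (auto simp: R_def)
qed

end

subsection \<open>Chains of lq-modular extensions\<close>

lemma i_modular_Suc:
  fixes k m K :: "'a::field set"
  assumes "is_subfield k" "k \<subseteq> m" "lq_modular k m" "i_modular i m K"
  shows "i_modular (Suc i) k K"
proof -
  obtain F where F: "F 0 = m" "F i = K" "\<forall>j\<le>i. is_subfield (F j)"
    "\<forall>j<i. F j \<subseteq> F (Suc j) \<and> lq_modular (F j) (F (Suc j))"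
    using assms(4) unfolding i_modular_def by blast
  define F' where "F' j = (case j of 0 \<Rightarrow> k | Suc j \<Rightarrow> F j)" for j
  have "F' 0 = k" "F' (Suc i) = K" using F(2) by (simp_all add: F'_def)
  moreover have "\<forall>j\<le>Suc i. is_subfield (F' j)"
    using F(3) assms(1) by (auto simp: F'_def split: nat.split)
  moreover have "\<forall>j<Suc i. F' j \<subseteq> F' (Suc j) \<and> lq_modular (F' j) (F' (Suc j))"
    using F(1,4) assms(2,3) by (auto simp: F'_def split: nat.split)
  ultimately show ?thesis unfolding i_modular_def by blast
qed

lemma i_modular_1:
  fixes k K :: "'a::field set"
  assumes "is_subfield k" "is_subfield K" "k \<subseteq> K" "lq_modular k K"
  shows "i_modular 1 k K"
proof -
  have "i_modular 0 K K" unfolding i_modular_def using assms(2) by (intro exI[of _ "\<lambda>_. K"]) simp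
  then show ?thesis using i_modular_Suc assms by fastforce
qed

lemma purely_inseparable_over:
  fixes k m K :: "'a::field set"
  assumes "purely_inseparable k K" "is_subfield m" "k \<subseteq> m" "m \<subseteq> K"
  shows "purely_inseparable m K" "purely_inseparable k m"
  using assms by (fastforce simp: purely_inseparable_def)+

context
  fixes ty :: "'a::field itself"
  assumes char_pos: "CHAR('a) > 0"
begin

lemma finite_gen_imp_finite_ext:
  fixes k K :: "'a set"
  assumes K: "purely_inseparable k K" and G: "finite G" "G \<subseteq> K"
  shows "finite_ext k (gen k G)"
proof -
  have "fin_ext k (gen k G)"
    using G(2) purely_inseparableD(4)[OF K] by (intro fin_ext_gen[OF char_pos purely_inseparableD(1)[OF K] G(1)]) blast
  then show ?thesis
    by (intro fin_ext_imp_finite_ext purely_inseparableD(1)[OF K] gen_subfield)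
qed

text \<open>\<open>K\<close> itself is the finite subextension to choose.\<close>

lemma finite_gen_imp_lq_modular:
  fixes k K :: "'a set"
  assumes K: "purely_inseparable k K" and G: "finite G" "gen k G = K"
  shows "lq_modular k K"
  unfolding lq_modular_def
  using finite_gen_imp_finite_ext[OF K G(1)] gen_eqD(3)[OF G(2)] G(2)
    purely_inseparableD[OF K] modular_refl[OF char_pos]
  by (intro exI[of _ K]) simp

text \<open>Over \<open>L = k(G)\<close> the field \<open>K\<close> is generated by
  \<open>R\<close>. A finite part of \<open>K\<close> then involves finitely many elements of
  \<open>R\<close>, which lie in one simple extension of \<open>k\<close>, so \<open>K\<close> is
  locally simple over \<open>L\<close>.\<close>

lemma locally_simple_imp_lq_modular:
  fixes k R K :: "'a set"
  assumes K: "purely_inseparable k K" and R: "locally_gen k R 1"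
    and G: "finite G" "gen R G = K"
  shows "lq_modular k K"
proof -
  note kK = purely_inseparableD[OF K]
  have GK: "G \<subseteq> K" and RK: "R \<subseteq> K" using gen_eqD[OF G(2)] by blast+
  let ?L = "gen k G"
  have L: "?L \<subseteq> K" using kK GK by (intro gen_least)
  have "locally_gen ?L K 1"
    unfolding locally_gen_def
  proof (intro allI impI)
    fix S assume S: "finite S \<and> S \<subseteq> K"
    have "K \<subseteq> gen ?L R"
      unfolding G(2)[symmetric] using gen_gens[of G k] gen_base[of ?L R] gen_gens[of R ?L]
      by (intro gen_least gen_subfield) blast+
    then obtain T where T: "finite T" "T \<subseteq> R" "S \<subseteq> gen ?L T"
      using gen_finite_support_set[of S ?L R] S by blast
    obtain H where H: "H \<subseteq> R" "finite H" "card H \<le> 1" "T \<subseteq> gen k H"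
      using locally_genE[OF R T(1,2)] .
    have "gen ?L T \<subseteq> gen ?L H"
    proof (rule gen_least[OF gen_subfield gen_base])
      show "T \<subseteq> gen ?L H" using H(4) gen_mono[OF gen_base order_refl, of k H G] by blast
    qed
    then show "\<exists>H\<subseteq>K. finite H \<and> card H \<le> 1 \<and> S \<subseteq> gen ?L H"
      using H RK T(3) by (intro exI[of _ H]) auto
  qed
  then have "modular ?L K"
    by (rule locally_simple_imp_modular[OF char_pos purely_inseparable_over(1)[OF K gen_subfield gen_base L]])
  then show ?thesis
    unfolding lq_modular_def using L finite_gen_imp_finite_ext[OF K G(1) GK] gen_base gen_subfield
    by (intro exI[of _ ?L]) blast
qed

text \<open>Iteration gives \<open>R = k(R^(p^n))\<close> for every \<open>n\<close>, which would
  collapse to \<open>k\<close> if \<open>n\<close> bounded the exponent.\<close>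

lemma relatively_perfect_unbounded:
  fixes k R :: "'a set"
  assumes k: "is_subfield k" and R: "gen k (frob 1 R) = R" "R \<noteq> k"
  shows "unbounded_exponent k R"
proof -
  have "\<not> frob n R \<subseteq> k" for n
  proof
    assume "frob n R \<subseteq> k"
    moreover have "R = gen k (frob n R \<union> {})"
      by (rule gen_frob_iterate[OF char_pos k]) (simp only: R(1) Un_empty_right)
    ultimately show False using gen_absorb[OF k, of "frob n R"] R(2) by simp
  qed
  then show ?thesis by (fastforce simp: unbounded_exponent_def frob_def)
qed

text \<open>Only the base field moves in the induction. Replacing \<open>k\<close> by the union of
  the tower in \<open>R\<close> is an lq-modular step that keeps \<open>R\<close> relatively perfect
  and \<open>K\<close> finitely generated over \<open>R\<close>, while \<open>R\<close> needs one
  local generator fewer.\<close>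

lemma i_modular_bound:
  fixes k R K :: "'a set"
  assumes "purely_inseparable k K" "is_subfield R" "k \<subseteq> R"
    and "gen k (frob 1 R) = R" "locally_gen k R (Suc t)" "finite G" "gen R G = K"
  shows "\<exists>i\<le>Suc t. i_modular i k K"
  using assms
proof (induction t arbitrary: k)
  case 0
  then have "lq_modular k K" using locally_simple_imp_lq_modular[of k K R G] by simp
  then have "i_modular 1 k K" using i_modular_1 purely_inseparableD[OF 0(1)] by blast
  then show ?case by auto
next
  case (Suc t)
  note kK = purely_inseparableD[OF Suc.prems(1)]
  have RK: "R \<subseteq> K" using gen_eqD[OF Suc.prems(7)] by blast
  show ?case
  \<comment> \<open>For \<open>R = k\<close> the tower offers no element to exchange for a
    generator, but then \<open>K\<close> is finite over \<open>k\<close>.\<close>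
  proof (cases "R = k")
    case True
    then have "lq_modular k K" using finite_gen_imp_lq_modular Suc.prems by blast
    then have "i_modular 1 k K" using i_modular_1 kK by blast
    then show ?thesis by (intro exI[of _ 1]) simp
  next
    case False
    have piR: "purely_inseparable k R"
      using purely_inseparable_over(2)[OF Suc.prems(1-3) RK] .
    let ?m = "\<Union>c. core k R c"
    note core = char_pos piR Suc.prems(5)
    have m: "is_subfield ?m" "k \<subseteq> ?m" "?m \<subseteq> R"
      using core_subfield_Union[OF core] core_base[OF core] core_subset_K[OF core] by blast+
    have "locally_gen ?m R (Suc (Suc t) - 1)"
      using relatively_perfect_unbounded[OF kK(1) Suc.prems(4) False] by (rule locally_gen_over_core[OF core])
    then have lgm: "locally_gen ?m R (Suc t)" by simp
    have "R \<subseteq> gen ?m (frob 1 R)"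
      using gen_mono[OF m(2) order_refl, of "frob 1 R"] Suc.prems(4) by simp
    moreover have "gen ?m (frob 1 R) \<subseteq> R"
      by (intro gen_least Suc.prems(2) m(3) frob_subset order_refl)
    ultimately have "gen ?m (frob 1 R) = R" by blast
    then obtain i where i: "i \<le> Suc t" "i_modular i ?m K"
      using Suc.IH[OF purely_inseparable_over(1)[OF Suc.prems(1) m(1,2)] Suc.prems(2) m(3) _ lgm Suc.prems(6,7)] m(3) RK
      by blast
    have "i_modular (Suc i) k K"
      using i_modular_Suc[OF kK(1) m(2) lq_modular_core[OF core] i(2)] .
    then show ?thesis using i(1) by blast
  qed
qed

subsection \<open>The relatively perfect part\<close>

lemma locally_gen_if_di_eq:
  fixes k K :: "'a set"
  assumes K: "purely_inseparable k K" and r: "di k K = enat r"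
  shows "locally_gen k K r"
  unfolding locally_gen_def
proof (intro allI impI)
  fix S assume S: "finite S \<and> S \<subseteq> K"
  obtain n where n: "exponent_le n k S"
    using finite_exponent[OF char_pos purely_inseparableD(1)[OF K], of S] S purely_inseparableD(4)[OF K] by blast
  let ?R = "root_part n k K"
  have SR: "S \<subseteq> ?R" using S exponent_leD[OF char_pos n] by (auto simp: root_part_def)
  have le: "gen_num k ?R \<le> enat r" unfolding r[symmetric] di_def by (rule SUP_upper) simp
  \<comment> \<open>The infimum is attained in effect: otherwise every generating set would have at
    least \<open>r + 1\<close> elements.\<close>
  have "\<exists>G. G \<subseteq> ?R \<and> gen k G = ?R \<and> ecard G \<le> enat r"
  proof (rule ccontr)
    assume "\<not> ?thesis"
    then have "eSuc (enat r) \<le> gen_num k ?R"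
      unfolding gen_num_def by (intro INF_greatest) (auto simp: not_le ileI1)
    then have "eSuc (enat r) \<le> enat r" using le by (rule order_trans)
    then show False by (simp add: eSuc_enat)
  qed
  then obtain G where G: "G \<subseteq> ?R" "gen k G = ?R" "ecard G \<le> enat r" by blast
  have "finite G" "card G \<le> r" using G(3) by (auto simp: ecard_def split: if_splits)
  then show "\<exists>G\<subseteq>K. finite G \<and> card G \<le> r \<and> S \<subseteq> gen k G"
    using G(1,2) SR by (intro exI[of _ G]) (auto simp: root_part_def)
qed

text \<open>Over \<open>k(K^p)\<close> all elements of \<open>K\<close> have exponent one, so local
  generation by \<open>r\<close> elements bounds the degree of every finitely generated subextension
  by \<open>p^r\<close>.\<close>

lemma finitely_generated_over_frob:
  fixes k K :: "'a set"
  assumes K: "purely_inseparable k K" "locally_gen k K r"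
  obtains G where "finite G" "G \<subseteq> K" "K = gen k (frob 1 K \<union> G)"
proof -
  note kK = purely_inseparableD[OF K(1)]
  let ?C = "gen k (frob 1 K)"
  have CK: "?C \<subseteq> K" using kK by (intro gen_least frob_subset) auto
  have pC: "exponent_le 1 ?C S" if "S \<subseteq> K" for S
    unfolding exponent_le_def using frob_mono[OF that, of 1] gen_gens by blast
  have bound: "fin_ext ?C (gen ?C S) \<and> ext_deg ?C (gen ?C S) \<le> CHAR('a) ^ r" if S: "finite S" "S \<subseteq> K" for S
  proof -
    obtain G where G: "G \<subseteq> K" "finite G" "card G \<le> r" "S \<subseteq> gen k G" using locally_genE[OF K(2) S] .
    have sub: "gen ?C S \<subseteq> gen ?C G"
    proof (rule gen_least[OF gen_subfield gen_base])
      show "S \<subseteq> gen ?C G" using G(4) gen_mono[OF gen_base order_refl, of k G "frob 1 K"] by blast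
    qed
    have finG: "fin_ext ?C (gen ?C G)" using p_basis[OF char_pos gen_subfield G(2) pC[OF G(1)]] by blast
    note args = gen_subfield gen_subfield gen_subfield gen_base sub finG
    have "ext_deg ?C (gen ?C S) \<le> ext_deg ?C (gen ?C G)"
      using ext_deg_mult[OF args] ext_deg_pos[OF gen_subfield gen_subfield sub fin_ext_upper[OF args]] by simp
    also have "\<dots> \<le> CHAR('a) ^ r" using ext_deg_le_power[OF char_pos gen_subfield G(2) pC[OF G(1)] G(3)] .
    finally show ?thesis using fin_ext_lower[OF args] by blast
  qed
  obtain G where "finite G" "G \<subseteq> K" "gen ?C G = K"
    using finitely_generated[OF char_pos gen_subfield kK(2) CK bound] by metis
  then show ?thesis using that[of G] by (simp add: gen_gen)
qed

text \<open>Write \<open>K = k(K^p, G)\<close> with \<open>G\<close> finite and \<open>n\<close>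
  bounding its exponent. Taking \<open>p^n\<close>-th powers removes \<open>G\<close>, so
  \<open>R = k(K^(p^n))\<close> is relatively perfect. Any relatively perfect \<open>F\<close>
  equals \<open>k(F^(p^n))\<close> and so lies in \<open>R\<close>, which shows that the greatest
  one exists and is \<open>R\<close>. Iterating the equation for \<open>K\<close> gives
  \<open>K = R(G)\<close>.\<close>

lemma rp_generates:
  fixes k K :: "'a set"
  assumes K: "purely_inseparable k K" "locally_gen k K r"
  obtains G n where "is_subfield (rp k K)" "k \<subseteq> rp k K" "rp k K \<subseteq> K" "gen k (frob 1 (rp k K)) = rp k K"
    "finite G" "G \<subseteq> K" "gen (rp k K) G = K" "exponent_le n k G"
proof -
  note kK = purely_inseparableD[OF K(1)]
  obtain G where G: "finite G" "G \<subseteq> K" "K = gen k (frob 1 K \<union> G)" using finitely_generated_over_frob[OF K] .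
  obtain n where n: "exponent_le n k G"
    using finite_exponent[OF char_pos kK(1) G(1)] G(2) kK(4) by blast
  define R where "R = gen k (frob n K)"
  have R: "is_subfield R" "k \<subseteq> R" by (simp_all add: R_def gen_subfield gen_base)
  have RK: "R \<subseteq> K" unfolding R_def using kK by (intro gen_least frob_subset) auto
  have frob_R: "gen k (frob 1 R) = gen k (frob (Suc n) K)"
    by (simp add: R_def gen_frob_gen[OF char_pos kK(1)] frob_frob)
  have "frob n K = frob n (gen k (frob 1 K \<union> G))" using G(3) by simp
  also have "\<dots> = gen (frob n k) (frob (Suc n) K \<union> frob n G)"
    by (simp add: frob_gen[OF char_pos] frob_Un frob_frob)
  also have "\<dots> \<subseteq> gen k (frob (Suc n) K)"
    using frob_subset[OF kK(1) order_refl, of n] gen_base[of k "frob (Suc n) K"] gen_gens[of "frob (Suc n) K" k] n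
    by (intro gen_least gen_subfield) (auto simp: exponent_le_def)
  finally have "R \<subseteq> gen k (frob 1 R)"
    unfolding frob_R unfolding R_def by (intro gen_least gen_subfield gen_base)
  moreover have "gen k (frob 1 R) \<subseteq> R" by (intro gen_least R frob_subset order_refl)
  ultimately have perfect: "gen k (frob 1 R) = R" by blast
  have "rp k K = R"
    unfolding rp_def
  proof (rule Greatest_equality)
    show "is_subfield R \<and> k \<subseteq> R \<and> R \<subseteq> K \<and> gen k ((\<lambda>x. x ^ CHAR('a)) ` R) = R"
      using R RK perfect by (simp add: frob_def)
  next
    fix F assume F: "is_subfield F \<and> k \<subseteq> F \<and> F \<subseteq> K \<and> gen k ((\<lambda>x. x ^ CHAR('a)) ` F) = F"
    then have "F = gen k (frob 1 F \<union> {})" by (simp add: frob_def)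
    then have "F = gen k (frob n F)" using gen_frob_iterate[OF char_pos kK(1), of F "{}" n] by simp
    also have "\<dots> \<subseteq> R" unfolding R_def using F by (intro gen_mono frob_mono) auto
    finally show "F \<subseteq> R" .
  qed
  moreover have "gen R G = K"
    using gen_frob_iterate[OF char_pos kK(1) G(3), of n] by (simp add: R_def gen_gen)
  ultimately show ?thesis using that[of G n] R RK perfect G(1,2) n by simp
qed

end

theorem mainTheorem17:
  fixes k K :: "'a::field set"
  assumes "CHAR('a) > 0"
    and "purely_inseparable k K"
    and "q_finite k K"
    and "unbounded_exponent k K"
  shows "dm k K \<le> di k (rp k K)"
proof (cases "di k (rp k K)")
  case (enat t)
  obtain r where "di k K = enat r" using assms(3) by (cases "di k K") (auto simp: q_finite_def)
  then have "locally_gen k K r" by (rule locally_gen_if_di_eq[OF assms(1,2)])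
  then obtain G n where R: "is_subfield (rp k K)" "k \<subseteq> rp k K" "rp k K \<subseteq> K"
    "gen k (frob 1 (rp k K)) = rp k K"
    and G: "finite G" "G \<subseteq> K" "gen (rp k K) G = K" "exponent_le n k G"
    using rp_generates[OF assms(1,2)] by metis
  have lg: "locally_gen k (rp k K) t"
    by (rule locally_gen_if_di_eq[OF assms(1) purely_inseparable_over(2)[OF assms(2) R(1-3)] enat])
  \<comment> \<open>For \<open>t = 0\<close> the relatively perfect part would be \<open>k\<close>,
    and \<open>K = k(G)\<close> would have bounded exponent. The induction can therefore start from
    one generator.\<close>
  have "t \<noteq> 0"
  proof
    note k = purely_inseparableD(1)[OF assms(2)]
    assume "t = 0"
    have "x \<in> k" if "x \<in> rp k K" for x
    proof -
      obtain H where "finite H" "card H \<le> t" "{x} \<subseteq> gen k H"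
        using locally_genE[OF lg, of "{x}"] \<open>x \<in> rp k K\<close> by auto
      with \<open>t = 0\<close> show ?thesis using gen_absorb[OF k, of "{}"] by simp
    qed
    then have "rp k K = k" using R(2) by blast
    then have "exponent_le n k K" using exponent_le_gen[OF assms(1) k G(4)] G(3) by simp
    then show False
      using assms(4) exponent_leD[OF assms(1)] unfolding unbounded_exponent_def by blast
  qed
  then obtain t' where t': "t = Suc t'" using not0_implies_Suc by blast
  obtain i where i: "i \<le> t" "i_modular i k K"
    using i_modular_bound[OF assms(1,2) R(1,2,4) _ G(1,3), of t'] lg t' by blast
  have "(LEAST i. i_modular i k K) \<le> t" using Least_le[of "\<lambda>i. i_modular i k K", OF i(2)] i(1) by simp
  then show ?thesis using i(2) enat by (auto simp: dm_def)
qed simp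

end
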